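(* Let $n\in\mathbb N$, $\alpha_1,\dots,\alpha_n\ge0$ and $x_1,\dots,x_n\in\mathbb R$. Then there exists a unique Nash equilibrium $X_1^*,\dots,X_n^*$ for mean-variance optimization on $[0,T]$. It is the unique solution of the system of second-order differential equations $$\alpha_i\sigma^2X_i(t)-2\lambda\ddot X_i(t)=b(t)+\gamma\sum_{j\neq i}\dot X_j(t)+\lambda\sum_{j\neq i}\ddot X_j(t),\qquad t\in[0,T],$$ with two-point boundary conditions $X_i(0)=x_i$ and $X_i(T)=0$, for $i=1,\dots,n$.
   Context: Fix $T>0$, $n\in\mathbb N$, a filtered probability space $(\Omega,\mathcal F,(\mathcal F_t)_{t\ge0},\mathbb P)$ carrying a standard $(\mathcal F_t)$-Brownian motion $W$, constants $S_0\in\mathbb R$, $\sigma\ge0$, $\gamma\ge0$, $\lambda>0$, and a deterministic continuous function $b:[0,T]\to\mathbb R$. The unaffected price is $S^0(t)=S_0+\sigma W(t)+\int_0^tb(s)\,ds$. For $x\in\mathbb R$, $\mathscr X(x,T)$ is the set of admissible strategies: processes $X=(X(t))_{t\in[0,T]}$ adapted to $(\mathcal F_t)$ with $X(0)=x$, $X(T)=0$, uniformly bounded (there is a constant $c$ with $|X(t,\omega)|\le c$ for all $t,\omega$), and absolutely continuous in the sense that there is a progressively measurable process $\dot X$ with $\int_0^T\dot X(t,\omega)^2dt<\infty$ and $X(t,\omega)=X(0,\omega)+\int_0^t\dot X(s,\omega)ds$ for all $t,\omega$. $\mathscr X_{\det}(x,T)$ denotes the deterministic strategies in $\mathscr X(x,T)$.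 When $n$ agents use strategies $X_1,\dots,X_n$, the price is $S^{X_1,\dots,X_n}(t)=S^0(t)+\gamma\sum_{j=1}^n(X_j(t)-X_j(0))+\lambda\sum_{j=1}^n\dot X_j(t)$ and agent $i$'s revenues are $\mathscr R(X_i|\mathbf X_{-i})=-\int_0^T\dot X_i(t)S^{X_1,\dots,X_n}(t)\,dt$, where $\mathbf X_{-i}=\{X_j: j\ne i\}$. Given initial positions $x_1,\dots,x_n$ and risk aversions $\alpha_1,\dots,\alpha_n\ge0$, a Nash equilibrium for mean-variance optimization is a collection of deterministic strategies $X_i^*\in\mathscr X_{\det}(x_i,T)$, $i=1,\dots,n$, such that for each $i$, $X_i^*$ maximizes $X\mapsto\mathbb E[\mathscr R(X|\mathbf X^*_{-i})]-\frac{\alpha_i}{2}\mathrm{var}(\mathscr R(X|\mathbf X^*_{-i}))$ over $X\in\mathscr X_{\det}(x_i,T)$ (here $\mathscr R(X|\mathbf X^*_{-i})$ is agent $i$'s revenue when agent $i$ uses $X$ and each agent $j\neq i$ uses $X_j^*$). *)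

theory Defs
  imports "HOL-Probability.Probability"
begin

definition brownian_motion :: "'a measure \<Rightarrow> (real \<Rightarrow> 'a \<Rightarrow> real) \<Rightarrow> bool" where
  "brownian_motion M W \<longleftrightarrow>
     prob_space M \<and>
     (\<forall>t\<ge>0. W t \<in> borel_measurable M) \<and>
     (\<forall>\<omega>\<in>space M. W 0 \<omega> = 0) \<and>
     (\<forall>\<omega>\<in>space M. continuous_on {0..} (\<lambda>t. W t \<omega>)) \<and>
     (\<forall>s t. 0 \<le> s \<and> s < t \<longrightarrow>
        distributed M lborel (\<lambda>\<omega>. W t \<omega> - W s \<omega>)
          (\<lambda>y. ennreal (normal_density 0 (sqrt (t - s)) y))) \<and>
     (\<forall>(k::nat) (\<tau>::nat \<Rightarrow> real). 0 \<le> \<tau> 0 \<and> (\<forall>j<k. \<tau> j < \<tau> (Suc j)) \<longrightarrow>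
        prob_space.indep_vars M (\<lambda>_. borel)
          (\<lambda>j \<omega>. W (\<tau> (Suc j)) \<omega> - W (\<tau> j) \<omega>) {..<k})"

definition adm_det :: "real \<Rightarrow> real \<Rightarrow> (real \<Rightarrow> real) \<Rightarrow> (real \<Rightarrow> real) \<Rightarrow> bool" where
  "adm_det x T X Xd \<longleftrightarrow>
     X 0 = x \<and> X T = 0 \<and>
     (\<exists>c. \<forall>t\<in>{0..T}. \<bar>X t\<bar> \<le> c) \<and>
     set_borel_measurable lborel {0..T} Xd \<and>
     set_integrable lborel {0..T} (\<lambda>t. (Xd t)\<^sup>2) \<and>
     (\<forall>t\<in>{0..T}. X t = X 0 + (LINT s:{0..t}|lborel. Xd s))"

definition price ::
  "(real \<Rightarrow> 'a \<Rightarrow> real) \<Rightarrow> real \<Rightarrow> real \<Rightarrow> (real \<Rightarrow> real) \<Rightarrow> real \<Rightarrow> real \<Rightarrow> nat \<Rightarrow>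
   (nat \<Rightarrow> real \<Rightarrow> real) \<Rightarrow> (nat \<Rightarrow> real \<Rightarrow> real) \<Rightarrow> real \<Rightarrow> 'a \<Rightarrow> real" where
  "price W S0 \<sigma> b \<gamma> lam n X Xd t \<omega> =
     S0 + \<sigma> * W t \<omega> + (LINT s:{0..t}|lborel. b s)
     + \<gamma> * (\<Sum>j<n. X j t - X j 0) + lam * (\<Sum>j<n. Xd j t)"

definition revenue ::
  "(real \<Rightarrow> 'a \<Rightarrow> real) \<Rightarrow> real \<Rightarrow> real \<Rightarrow> real \<Rightarrow> (real \<Rightarrow> real) \<Rightarrow> real \<Rightarrow> real \<Rightarrow> nat \<Rightarrow>
   (nat \<Rightarrow> real \<Rightarrow> real) \<Rightarrow> (nat \<Rightarrow> real \<Rightarrow> real) \<Rightarrow> nat \<Rightarrow> 'a \<Rightarrow> real" where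
  "revenue W T S0 \<sigma> b \<gamma> lam n X Xd i \<omega> =
     - (LINT t:{0..T}|lborel. Xd i t * price W S0 \<sigma> b \<gamma> lam n X Xd t \<omega>)"

definition mean_var ::
  "'a measure \<Rightarrow> real \<Rightarrow> ('a \<Rightarrow> real) \<Rightarrow> real" where
  "mean_var M a R = prob_space.expectation M R - a / 2 * prob_space.variance M R"

definition nash_mv ::
  "'a measure \<Rightarrow> (real \<Rightarrow> 'a \<Rightarrow> real) \<Rightarrow> real \<Rightarrow> real \<Rightarrow> real \<Rightarrow> (real \<Rightarrow> real) \<Rightarrow> real \<Rightarrow> real
   \<Rightarrow> nat \<Rightarrow> (nat \<Rightarrow> real) \<Rightarrow> (nat \<Rightarrow> real)
   \<Rightarrow> (nat \<Rightarrow> real \<Rightarrow> real) \<Rightarrow> (nat \<Rightarrow> real \<Rightarrow> real) \<Rightarrow> bool" where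
  "nash_mv M W T S0 \<sigma> b \<gamma> lam n x \<alpha> X Xd \<longleftrightarrow>
     (\<forall>i<n. adm_det (x i) T (X i) (Xd i)) \<and>
     (\<forall>i<n. \<forall>Y Yd. adm_det (x i) T Y Yd \<longrightarrow>
        mean_var M (\<alpha> i) (revenue W T S0 \<sigma> b \<gamma> lam n (X(i := Y)) (Xd(i := Yd)) i)
        \<le> mean_var M (\<alpha> i) (revenue W T S0 \<sigma> b \<gamma> lam n X Xd i))"

definition solves_bvp ::
  "real \<Rightarrow> real \<Rightarrow> (real \<Rightarrow> real) \<Rightarrow> real \<Rightarrow> real \<Rightarrow> nat \<Rightarrow> (nat \<Rightarrow> real) \<Rightarrow> (nat \<Rightarrow> real)
   \<Rightarrow> (nat \<Rightarrow> real \<Rightarrow> real) \<Rightarrow> bool" where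
  "solves_bvp T \<sigma> b \<gamma> lam n x \<alpha> X \<longleftrightarrow>
     (\<exists>X1 X2 :: nat \<Rightarrow> real \<Rightarrow> real.
        \<forall>i<n. X i 0 = x i \<and> X i T = 0 \<and>
          (\<forall>t\<in>{0..T}.
             (X i has_real_derivative X1 i t) (at t within {0..T}) \<and>
             (X1 i has_real_derivative X2 i t) (at t within {0..T}) \<and>
             \<alpha> i * \<sigma>\<^sup>2 * X i t - 2 * lam * X2 i t =
               b t + \<gamma> * (\<Sum>j\<in>{..<n} - {i}. X1 j t) + lam * (\<Sum>j\<in>{..<n} - {i}. X2 j t)))"

end

theory Submission
  imports Defs
begin

text \<open>For deterministic strategies the mean-variance functional is, by Fubini and the covariance
  \<open>min s t\<close> of Brownian motion, an explicit concave quadratic functional of the trading rate. Hence a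
  profile is an equilibrium iff for every agent the once-integrated Euler-Lagrange expression \<open>foc\<close> is
  constant almost everywhere. Testing the difference of two equilibria with itself and summing over
  the agents, the permanent-impact terms turn into vanishing boundary terms and the rest is positive
  definite, so equilibria are unique. Every solution of the boundary value problem satisfies the
  first-order condition, so it is an equilibrium and inherits uniqueness.

  For existence, the first-order condition is an equation \<open>P w + Q K w = Q f\<close> for trading rates with
  mean zero, where \<open>P\<close> is a positive definite matrix, \<open>Q\<close> subtracts the mean and \<open>K\<close> is a Volterra
  operator that is accretive on such rates. A damped iteration \<open>w - \<rho> (P w + Q K w - Q f)\<close>
  contracts to a continuous \<open>w\<close>, which the equation itself shows to be differentiable.\<close>

subsection \<open>Square-integrable rates and their primitives\<close>

text \<open>In terms of rates the liquidation constraint is linear: the admissible perturbations of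
  a rate are exactly the square-integrable functions of mean zero. The constant in the first-order
  condition is the Lagrange multiplier of this constraint. The obstacle to existence is that
  \<open>K\<close> need not be small when \<open>T\<close>, \<gamma> or the risk aversions are
  large, so inverting \<open>P\<close> and iterating need not converge. What is available instead is
  coercivity: paired with \<open>w\<close>, the operator gives at least \<open>lam\<close> times the
  squared norm of \<open>w\<close>. A step of size \<rho> then multiplies the squared norm by at
  most \<open>1 - 2 * \<rho> * lam + O(\<rho>^2)\<close>, which is below 1 for small \<rho>,
  whatever the horizon. The rates of an equilibrium are a priori only square-integrable. Their
  smoothness is obtained indirectly: a smooth solution of the boundary value problem is an
  equilibrium, and uniqueness identifies every other equilibrium with it.\<close>

locale horizon =
  fixes T :: real
  assumes T_pos: "0 < T"
begin

abbreviation N :: "real measure" where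
  "N \<equiv> restrict_space lborel {0..T}"

text \<open>With an indicator under one fixed finite measure, bounds hold for every real
  \<open>t\<close> without a side condition, and Fubini applies to a single product measure.\<close>

definition prim :: "(real \<Rightarrow> real) \<Rightarrow> real \<Rightarrow> real" where
  "prim f t = (\<integral>s. indicator {..t} s * f s \<partial>N)"

definition sq_int :: "(real \<Rightarrow> real) \<Rightarrow> bool" where
  "sq_int f \<longleftrightarrow> f \<in> borel_measurable N \<and> integrable N (\<lambda>t. (f t)\<^sup>2)"

lemma space_N [simp]: "space N = {0..T}"
  by (simp add: space_restrict_space)

lemma emeasure_N: "emeasure N (space N) = ennreal T"
  using T_pos by (simp add: emeasure_restrict_space)

lemma finite_measure_N: "finite_measure N"
  by standard (simp only: emeasure_N, simp)

sublocale N: finite_measure N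
  by (rule finite_measure_N)

sublocale NN: pair_sigma_finite N N
  by standard

lemma measure_N [simp]: "measure N {0..T} = T"
  using emeasure_N T_pos by (simp add: measure_def)

lemma measurable_ident_N [measurable]: "(\<lambda>x. x) \<in> borel_measurable N"
  by (rule measurable_restrict_space1) simp

lemma set_integrable_N: "set_integrable lborel {0..T} f \<longleftrightarrow> integrable N f"
  for f :: "real \<Rightarrow> real"
  by (subst integrable_restrict_space) (auto simp: set_integrable_def)

lemma set_integral_N: "(LINT s:{0..T}|lborel. f s) = (\<integral>s. f s \<partial>N)"
  for f :: "real \<Rightarrow> real"
  by (subst integral_restrict_space) (auto simp: set_lebesgue_integral_def)

lemma set_measurable_N: "set_borel_measurable lborel {0..T} f \<longleftrightarrow> f \<in> borel_measurable N"
  for f :: "real \<Rightarrow> real"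
  by (subst borel_measurable_restrict_space_iff) (auto simp: set_borel_measurable_def)

lemma prim_eq_set_integral:
  assumes "t \<in> {0..T}"
  shows "(LINT s:{0..t}|lborel. f s) = prim f t"
  unfolding prim_def set_lebesgue_integral_def
  using assms
  by (subst integral_restrict_space) (auto intro!: Bochner_Integration.integral_cong split: split_indicator)

lemma prim_0: "prim f 0 = 0"
  unfolding prim_eq_set_integral[symmetric, of 0, simplified, OF less_imp_le[OF T_pos]]
  by (simp add: set_lebesgue_integral_def)
    (rule integral_eq_zero_AE, use AE_lborel_singleton[of 0] in eventually_elim, auto split: split_indicator)

lemma prim_T: "prim f T = (\<integral>s. f s \<partial>N)"
  unfolding prim_def by (rule Bochner_Integration.integral_cong) auto

lemma AE_N_singleton: "AE s in N. s \<noteq> t"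
  using AE_lborel_singleton[of t] by (subst AE_restrict_space_iff) auto

text \<open>Points are null sets. The strict form makes the regions \<open>s \<le> t\<close> and
  \<open>t < s\<close> partition the square in \<open>prim_by_parts\<close>.\<close>

lemma prim_strict:
  assumes [measurable]: "f \<in> borel_measurable N"
  shows "prim f t = (\<integral>s. indicator {..<t} s * f s \<partial>N)"
  unfolding prim_def
proof (rule integral_cong_AE)
  show "AE s in N. indicator {..t} s * f s = indicator {..<t} s * f s"
    using AE_N_singleton[of t] by eventually_elim (auto split: split_indicator)
qed measurable

lemma integrable_ind_N:
  fixes f :: "real \<Rightarrow> real"
  assumes "integrable N f" "A \<in> sets borel"
  shows "integrable N (\<lambda>s. indicator A s * f s)"
proof -
  have [measurable]: "f \<in> borel_measurable N" using assms by simp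
  have [measurable]: "A \<in> sets borel" by fact
  show ?thesis
    by (rule Bochner_Integration.integrable_bound[OF assms(1)]) (auto split: split_indicator)
qed

lemma prim_add:
  assumes "integrable N f" "integrable N g"
  shows "prim (\<lambda>s. f s + g s) t = prim f t + prim g t"
  using integrable_ind_N[OF assms(1), of "{..t}"] integrable_ind_N[OF assms(2), of "{..t}"]
  by (simp add: prim_def ring_distribs)

lemma prim_cmult: "prim (\<lambda>s. c * f s) t = c * prim f t"
  by (simp add: prim_def mult.left_commute)

lemma prim_diff:
  assumes "integrable N f" "integrable N g"
  shows "prim (\<lambda>s. f s - g s) t = prim f t - prim g t"
  using integrable_ind_N[OF assms(1), of "{..t}"] integrable_ind_N[OF assms(2), of "{..t}"]
  by (simp add: prim_def ring_distribs)

lemma prim_sum: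
  assumes "\<And>i. i \<in> I \<Longrightarrow> integrable N (f i)"
  shows "prim (\<lambda>s. \<Sum>i\<in>I. f i s) t = (\<Sum>i\<in>I. prim (f i) t)"
  unfolding prim_def sum_distrib_left
  by (rule Bochner_Integration.integral_sum) (auto intro!: integrable_ind_N assms)

lemma prim_const: "t \<in> {0..T} \<Longrightarrow> prim (\<lambda>_. c) t = c * t"
  unfolding prim_eq_set_integral[symmetric] by (simp add: set_lebesgue_integral_def)

lemma prim_cong_AE:
  assumes [measurable]: "f \<in> borel_measurable N" "g \<in> borel_measurable N"
    and "AE s in N. f s = g s"
  shows "prim f t = prim g t"
  unfolding prim_def
  by (rule integral_cong_AE) (use assms(3) in \<open>auto elim: eventually_mono\<close>)

lemma prim_cong: "(\<And>s. s \<in> {0..T} \<Longrightarrow> f s = g s) \<Longrightarrow> prim f t = prim g t"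
  unfolding prim_def by (rule Bochner_Integration.integral_cong) auto

lemma borel_measurable_prim [measurable]:
  assumes [measurable]: "f \<in> borel_measurable N"
  shows "prim f \<in> borel_measurable N"
proof -
  have "(\<lambda>t. \<integral>s. (if s \<le> t then f s else 0) \<partial>N) \<in> borel_measurable N"
    by measurable
  also have "(\<lambda>t. \<integral>s. (if s \<le> t then f s else 0) \<partial>N) = prim f"
    unfolding prim_def by (auto intro!: ext Bochner_Integration.integral_cong split: split_indicator)
  finally show ?thesis .
qed

lemma abs_prim_le:
  assumes "integrable N f"
  shows "\<bar>prim f t\<bar> \<le> (\<integral>s. \<bar>f s\<bar> \<partial>N)"
proof -
  have "\<bar>prim f t\<bar> \<le> (\<integral>s. \<bar>indicator {..t} s * f s\<bar> \<partial>N)"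
    unfolding prim_def by (rule integral_abs_bound)
  also have "\<dots> \<le> (\<integral>s. \<bar>f s\<bar> \<partial>N)"
    by (rule integral_mono) (use assms integrable_ind_N[OF assms, of "{..t}"] in \<open>auto split: split_indicator\<close>)
  finally show ?thesis .
qed

lemma integrable_bounded_N:
  fixes f :: "real \<Rightarrow> real"
  assumes "f \<in> borel_measurable N" "\<And>t. t \<in> {0..T} \<Longrightarrow> \<bar>f t\<bar> \<le> c"
  shows "integrable N f"
  by (rule N.integrable_const_bound[where B=c]) (use assms in auto)

lemma sq_int_bounded:
  assumes [measurable]: "f \<in> borel_measurable N" and "\<And>t. t \<in> {0..T} \<Longrightarrow> \<bar>f t\<bar> \<le> c"
  shows "sq_int f"
  unfolding sq_int_def
proof
  show "integrable N (\<lambda>t. (f t)\<^sup>2)"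
  proof (rule integrable_bounded_N[where c="c\<^sup>2"])
    fix t assume "t \<in> {0..T}"
    then show "\<bar>(f t)\<^sup>2\<bar> \<le> c\<^sup>2" using assms(2)[of t] by (simp add: abs_le_square_iff[symmetric])
  qed measurable
qed fact

lemma sq_int_measurable: "sq_int f \<Longrightarrow> f \<in> borel_measurable N"
  by (simp add: sq_int_def)

lemma sq_int_square: "sq_int f \<Longrightarrow> integrable N (\<lambda>t. (f t)\<^sup>2)"
  by (simp add: sq_int_def)

lemma sq_int_mult:
  assumes "sq_int f" "sq_int g"
  shows "integrable N (\<lambda>t. f t * g t)"
proof (rule Bochner_Integration.integrable_bound)
  show "integrable N (\<lambda>t. (f t)\<^sup>2 + (g t)\<^sup>2)" using assms by (simp add: sq_int_def)
  show "(\<lambda>t. f t * g t) \<in> borel_measurable N"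
    using assms by (auto simp: sq_int_def)
  have "\<bar>a * c\<bar> \<le> a\<^sup>2 + c\<^sup>2" for a c :: real
    using sum_squares_bound[of a c] sum_squares_bound[of "-a" c] by (simp add: abs_le_iff)
  then show "AE x in N. norm (f x * g x) \<le> norm ((f x)\<^sup>2 + (g x)\<^sup>2)"
    by auto
qed

lemma sq_int_const: "sq_int (\<lambda>_. c)"
  by (auto simp: sq_int_def)

lemma sq_int_integrable:
  assumes "sq_int f" shows "integrable N f"
  using sq_int_mult[OF assms sq_int_const[of 1]] by simp

lemma sq_int_cmult: "sq_int f \<Longrightarrow> sq_int (\<lambda>t. c * f t)"
  by (auto simp: sq_int_def power_mult_distrib)

lemma sq_int_add:
  assumes "sq_int f" "sq_int g"
  shows "sq_int (\<lambda>t. f t + g t)"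
  using assms sq_int_mult[OF assms] by (auto simp: sq_int_def power2_sum mult.assoc)

lemma sq_int_diff: "sq_int f \<Longrightarrow> sq_int g \<Longrightarrow> sq_int (\<lambda>t. f t - g t)"
  using sq_int_add[of f "\<lambda>t. -1 * g t"] sq_int_cmult[of g "-1"] by simp

lemma sq_int_sum: "(\<And>i. i \<in> I \<Longrightarrow> sq_int (f i)) \<Longrightarrow> sq_int (\<lambda>t. \<Sum>i\<in>I. f i t)"
  by (induction I rule: infinite_finite_induct) (auto intro: sq_int_add sq_int_const)

lemma sq_int_prim:
  assumes "integrable N f" shows "sq_int (prim f)"
  by (rule sq_int_bounded[OF borel_measurable_prim abs_prim_le]) (use assms in auto)

lemma sq_int_cong:
  assumes "sq_int f" "\<And>t. t \<in> {0..T} \<Longrightarrow> f t = g t"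
  shows "sq_int g"
proof -
  have "f \<in> borel_measurable N \<longleftrightarrow> g \<in> borel_measurable N"
    by (rule measurable_cong) (use assms(2) in auto)
  moreover have "integrable N (\<lambda>t. (f t)\<^sup>2) \<longleftrightarrow> integrable N (\<lambda>t. (g t)\<^sup>2)"
    by (rule Bochner_Integration.integrable_cong) (use assms(2) in auto)
  ultimately show ?thesis using assms(1) by (simp add: sq_int_def)
qed

lemma sq_int_continuous:
  assumes "continuous_on {0..T} f" shows "sq_int f"
proof -
  obtain c where "\<And>t. t \<in> {0..T} \<Longrightarrow> \<bar>f t\<bar> \<le> c"
    using compact_imp_bounded[OF compact_continuous_image[OF assms compact_Icc]]
    unfolding bounded_iff by fastforce
  moreover have "f \<in> borel_measurable N"
    using borel_measurable_continuous_on_restrict[OF assms]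
      measurable_cong_sets[OF sets_restrict_space_cong[OF sets_lborel] refl] by blast
  ultimately show ?thesis by (rule sq_int_bounded[rotated])
qed

section \<open>Integration by parts and norm bounds for primitives\<close>

text \<open>Fubini on the two triangles of the square, so integrability of both functions suffices.
  When one of the total integrals vanishes, this is the skew-symmetry of \<open>prim\<close>, from
  which the signs of all later pairings come.\<close>

lemma prim_by_parts:
  assumes f: "integrable N f" and g: "integrable N g"
  shows "(\<integral>t. f t * prim g t \<partial>N) + (\<integral>t. prim f t * g t \<partial>N) = (\<integral>t. f t \<partial>N) * (\<integral>t. g t \<partial>N)"
proof -
  have [measurable]: "f \<in> borel_measurable N" "g \<in> borel_measurable N" using f g by auto
  have fg: "integrable (N \<Otimes>\<^sub>M N) (\<lambda>(t, s). f t * g s)"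
  proof (rule NN.Fubini_integrable)
    show "integrable N (\<lambda>x. \<integral>y. norm (case (x, y) of (t, s) \<Rightarrow> f t * g s) \<partial>N)"
      using f g by (simp add: abs_mult)
    show "AE x in N. integrable N (\<lambda>y. case (x, y) of (t, s) \<Rightarrow> f t * g s)"
      using g by simp
  qed measurable
  have le: "integrable (N \<Otimes>\<^sub>M N) (\<lambda>(t, s). (if s \<le> t then 1 else 0) * (f t * g s))"
    by (rule Bochner_Integration.integrable_bound[OF fg]) auto
  have gt: "integrable (N \<Otimes>\<^sub>M N) (\<lambda>(t, s). (if t < s then 1 else 0) * (f t * g s))"
    by (rule Bochner_Integration.integrable_bound[OF fg]) auto
  have 1: "(\<integral>t. f t * prim g t \<partial>N) = (\<integral>t. \<integral>s. (if s \<le> t then 1 else 0) * (f t * g s) \<partial>N \<partial>N)"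
    unfolding prim_def integral_mult_right_zero[symmetric]
    by (intro Bochner_Integration.integral_cong) (auto split: split_indicator)
  have "(\<integral>t. prim f t * g t \<partial>N) = (\<integral>s. \<integral>t. (if t < s then 1 else 0) * (f t * g s) \<partial>N \<partial>N)"
    unfolding prim_strict[OF \<open>f \<in> borel_measurable N\<close>] integral_mult_left_zero[symmetric]
    by (intro Bochner_Integration.integral_cong) (auto split: split_indicator)
  also have "\<dots> = (\<integral>t. \<integral>s. (if t < s then 1 else 0) * (f t * g s) \<partial>N \<partial>N)"
    using NN.Fubini_integral[OF gt] by simp
  finally have 2: "(\<integral>t. prim f t * g t \<partial>N) = (\<integral>t. \<integral>s. (if t < s then 1 else 0) * (f t * g s) \<partial>N \<partial>N)" .
  have "(\<integral>t. f t * prim g t \<partial>N) + (\<integral>t. prim f t * g t \<partial>N)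
      = integral\<^sup>L (N \<Otimes>\<^sub>M N) (\<lambda>(t, s). (if s \<le> t then 1 else 0) * (f t * g s))
      + integral\<^sup>L (N \<Otimes>\<^sub>M N) (\<lambda>(t, s). (if t < s then 1 else 0) * (f t * g s))"
    unfolding 1 2 using NN.integral_fst'[OF le] NN.integral_fst'[OF gt] by simp
  also have "\<dots> = integral\<^sup>L (N \<Otimes>\<^sub>M N) (\<lambda>(t, s). f t * g s)"
    by (subst Bochner_Integration.integral_add[OF le gt, symmetric])
      (auto intro!: Bochner_Integration.integral_cong)
  also have "\<dots> = (\<integral>t. \<integral>s. f t * g s \<partial>N \<partial>N)"
    using NN.integral_fst'[OF fg] by simp
  finally show ?thesis by simp
qed

text \<open>Cauchy-Schwarz against the constant 1, read off from the nonnegative squared deviation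
  of \<open>f\<close> from its mean.\<close>

lemma integral_square_le:
  assumes "sq_int f"
  shows "(\<integral>t. f t \<partial>N)\<^sup>2 \<le> T * (\<integral>t. (f t)\<^sup>2 \<partial>N)"
proof -
  define m where "m = (\<integral>t. f t \<partial>N) / T"
  have "0 \<le> (\<integral>t. (f t - m)\<^sup>2 \<partial>N)" by simp
  also have "\<dots> = (\<integral>t. (f t)\<^sup>2 - 2 * m * f t + m\<^sup>2 \<partial>N)"
    by (intro Bochner_Integration.integral_cong) (auto simp: power2_diff)
  also have "\<dots> = (\<integral>t. (f t)\<^sup>2 \<partial>N) - 2 * m * (\<integral>t. f t \<partial>N) + m\<^sup>2 * T"
    using sq_int_integrable[OF assms] sq_int_square[OF assms] by simp
  finally show ?thesis using T_pos by (simp add: m_def power2_eq_square field_simps)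
qed

text \<open>A bound uniform in \<open>t\<close> by a square norm: this smoothing by
  \<open>prim\<close> is what lets mean-square estimates control pointwise values in
  \<open>coupling_bound\<close>.\<close>

lemma prim_square_le:
  assumes "sq_int f"
  shows "(prim f t)\<^sup>2 \<le> T * (\<integral>t. (f t)\<^sup>2 \<partial>N)"
proof -
  have [simp]: "(indicator {..t} s :: real)\<^sup>2 = indicator {..t} s" for s
    by (simp split: split_indicator)
  have "sq_int (\<lambda>s. indicator {..t} s * f s)"
    using assms integrable_ind_N[of "\<lambda>t. (f t)\<^sup>2" "{..t}"]
    by (auto simp: sq_int_def power_mult_distrib)
  from integral_square_le[OF this]
  have "(prim f t)\<^sup>2 \<le> T * (\<integral>s. (indicator {..t} s * f s)\<^sup>2 \<partial>N)" by (simp add: prim_def)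
  also have "\<dots> \<le> T * (\<integral>t. (f t)\<^sup>2 \<partial>N)"
    by (intro mult_left_mono integral_mono)
      (use T_pos sq_int_square[OF assms] sq_int_square[OF \<open>sq_int (\<lambda>s. indicator {..t} s * f s)\<close>] in \<open>auto split: split_indicator\<close>)
  finally show ?thesis .
qed

text \<open>On continuous functions \<open>prim\<close> agrees with the gauge integral, whose
  fundamental theorem gives the derivative within the closed interval, endpoints included.\<close>

lemma prim_has_derivative:
  assumes "continuous_on {0..T} f" "t \<in> {0..T}"
  shows "(prim f has_real_derivative f t) (at t within {0..T})"
proof -
  have eq: "integral {0..s} f = prim f s" if "s \<in> {0..T}" for s
  proof -
    have "set_integrable lborel {0..s} f"
      unfolding set_integrable_def
      by (rule borel_integrable_compact) (use that in \<open>auto intro: continuous_on_subset[OF assms(1)]\<close>)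
    from set_borel_integral_eq_integral(2)[OF this] show ?thesis
      by (simp add: prim_eq_set_integral[OF that])
  qed
  have "((\<lambda>u. integral {0..u} f) has_real_derivative f t) (at t within {0..T})"
    by (rule integral_has_real_derivative) (use assms in auto)
  then show ?thesis
    unfolding has_field_derivative_def
    by (rule has_derivative_transform[rotated 2]) (use assms eq in auto)
qed

lemma continuous_on_prim:
  assumes "continuous_on {0..T} f"
  shows "continuous_on {0..T} (prim f)"
  by (rule DERIV_continuous_on[OF prim_has_derivative[OF assms]])

lemma prim_eqI:
  assumes "\<And>t. t \<in> {0..T} \<Longrightarrow> (F has_real_derivative f t) (at t within {0..T})"
    "continuous_on {0..T} f" "t \<in> {0..T}"
  shows "F t = F 0 + prim f t"
proof -
  have "((\<lambda>t. F t - prim f t) has_derivative (\<lambda>h. 0)) (at s within {0..T})" if "s \<in> {0..T}" for s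
    using DERIV_diff[OF assms(1)[OF that] prim_has_derivative[OF assms(2) that]]
    by (simp add: has_field_derivative_def lambda_zero)
  from has_derivative_zero_constant[OF _ this]
  obtain c where "\<forall>s\<in>{0..T}. F s - prim f s = c" by auto
  from this[THEN bspec, of t] this[THEN bspec, of 0] show ?thesis
    using assms(3) T_pos by (simp add: prim_0)
qed

end

subsection \<open>Integrals of Brownian motion\<close>

lemma brownian_prob_space: "brownian_motion M W \<Longrightarrow> prob_space M"
  by (simp add: brownian_motion_def)

lemma brownian_measurable: "brownian_motion M W \<Longrightarrow> 0 \<le> t \<Longrightarrow> W t \<in> borel_measurable M"
  by (simp add: brownian_motion_def)

lemma brownian_increment:
  assumes "brownian_motion M W" "0 \<le> s" "s < t"
  shows "integrable M (\<lambda>\<omega>. W t \<omega> - W s \<omega>)" (is ?i1)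
    "(\<integral>\<omega>. W t \<omega> - W s \<omega> \<partial>M) = 0" (is ?e1)
    "integrable M (\<lambda>\<omega>. (W t \<omega> - W s \<omega>)\<^sup>2)" (is ?i2)
    "(\<integral>\<omega>. (W t \<omega> - W s \<omega>)\<^sup>2 \<partial>M) = t - s" (is ?e2)
proof -
  interpret prob_space M using assms(1) by (rule brownian_prob_space)
  have D: "distributed M lborel (\<lambda>\<omega>. W t \<omega> - W s \<omega>)
          (\<lambda>y. ennreal (normal_density 0 (sqrt (t - s)) y))"
    using assms by (auto simp: brownian_motion_def)
  have pos: "0 < sqrt (t - s)" using assms by simp
  show ?i1
    using integrable_normal_moment_nz_1[OF pos, of 0] distributed_integrable[OF D, of "\<lambda>x. x"] by simp
  show ?e1
    using integral_normal_moment_nz_1[OF pos, of 0] distributed_integral[OF D, of "\<lambda>x. x"] by simp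
  show ?i2
    using integrable_normal_moment[OF pos, of 0 2] distributed_integrable[OF D, of "\<lambda>x. x\<^sup>2"] by simp
  show ?e2
    using integral_normal_moment_even[OF pos, of 0 1] distributed_integral[OF D, of "\<lambda>x. x\<^sup>2"] assms
    by (simp add: fact_numeral)
qed

lemma brownian_moments:
  assumes "brownian_motion M W" "0 \<le> t"
  shows "integrable M (W t)" "(\<integral>\<omega>. W t \<omega> \<partial>M) = 0"
    "integrable M (\<lambda>\<omega>. (W t \<omega>)\<^sup>2)" "(\<integral>\<omega>. (W t \<omega>)\<^sup>2 \<partial>M) = t"
proof -
  have W0: "W 0 \<omega> = 0" if "\<omega> \<in> space M" for \<omega>
    using assms that by (auto simp: brownian_motion_def)
  have "integrable M (W t) \<and> (\<integral>\<omega>. W t \<omega> \<partial>M) = 0 \<and>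
    integrable M (\<lambda>\<omega>. (W t \<omega>)\<^sup>2) \<and> (\<integral>\<omega>. (W t \<omega>)\<^sup>2 \<partial>M) = t"
  proof (cases "t = 0")
    case True
    then show ?thesis using W0
      by (simp cong: Bochner_Integration.integrable_cong Bochner_Integration.integral_cong)
  next
    case False
    then show ?thesis using brownian_increment[OF assms(1), of 0 t] assms(2) W0
      by (simp cong: Bochner_Integration.integrable_cong Bochner_Integration.integral_cong)
  qed
  then show "integrable M (W t)" "(\<integral>\<omega>. W t \<omega> \<partial>M) = 0"
    "integrable M (\<lambda>\<omega>. (W t \<omega>)\<^sup>2)" "(\<integral>\<omega>. (W t \<omega>)\<^sup>2 \<partial>M) = t" by auto
qed

lemma brownian_covariance_less:
  assumes B: "brownian_motion M W" and "0 \<le> s" "s < t"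
  shows "(\<integral>\<omega>. W s \<omega> * W t \<omega> \<partial>M) = s"
proof -
  interpret prob_space M using assms(1) by (rule brownian_prob_space)
  have W0: "W 0 \<omega> = 0" if "\<omega> \<in> space M" for \<omega>
    using assms that by (auto simp: brownian_motion_def)
  have eq: "(\<integral>\<omega>. W s \<omega> * (W t \<omega> - W s \<omega>) \<partial>M) = 0 \<and> integrable M (\<lambda>\<omega>. W s \<omega> * (W t \<omega> - W s \<omega>))"
  proof (cases "s = 0")
    case True
    then show ?thesis using W0
      by (simp cong: Bochner_Integration.integrable_cong Bochner_Integration.integral_cong)
  next
    case False
    \<comment> \<open>The partition \<open>0 < s < t\<close>. Independence is stated for strictly
      increasing times, hence the separate case \<open>s = 0\<close>.\<close>
    define \<tau> where "\<tau> = (\<lambda>j::nat. if j = 0 then 0 else if j = 1 then s else t)"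
    have "indep_vars (\<lambda>_. borel) (\<lambda>j \<omega>. W (\<tau> (Suc j)) \<omega> - W (\<tau> j) \<omega>) {..<2::nat}"
    proof -
      have "0 \<le> \<tau> 0 \<and> (\<forall>j<2. \<tau> j < \<tau> (Suc j))"
        using False assms by (auto simp: \<tau>_def less_2_cases_iff)
      with B show ?thesis unfolding brownian_motion_def by blast
    qed
    note iv = this
    have "0 < s" using False assms by simp
    note inc1 = brownian_increment[OF B order_refl this]
    note inc2 = brownian_increment[OF B assms(2,3)]
    have int: "integrable M (\<lambda>\<omega>. W (\<tau> (Suc j)) \<omega> - W (\<tau> j) \<omega>)" if "j \<in> {..<2}" for j
      using that inc1(1) inc2(1) by (auto simp: \<tau>_def less_2_cases_iff)
    have "integrable M (\<lambda>\<omega>. (W s \<omega> - W 0 \<omega>) * (W t \<omega> - W s \<omega>))"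
      using indep_vars_integrable[OF _ iv int] by (simp add: \<tau>_def numeral_2_eq_2)
    moreover have "(\<integral>\<omega>. (W s \<omega> - W 0 \<omega>) * (W t \<omega> - W s \<omega>) \<partial>M) = 0"
      using indep_vars_lebesgue_integral[OF _ iv int] inc2(2) by (simp add: \<tau>_def numeral_2_eq_2)
    ultimately show ?thesis using W0
      by (simp cong: Bochner_Integration.integrable_cong Bochner_Integration.integral_cong)
  qed
  have "(\<integral>\<omega>. W s \<omega> * W t \<omega> \<partial>M) = (\<integral>\<omega>. (W s \<omega>)\<^sup>2 + W s \<omega> * (W t \<omega> - W s \<omega>) \<partial>M)"
    by (intro Bochner_Integration.integral_cong) (auto simp: power2_eq_square algebra_simps)
  also have "\<dots> = s"
    using eq brownian_moments[OF B \<open>0 \<le> s\<close>] by simp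
  finally show ?thesis .
qed

lemma brownian_covariance:
  assumes B: "brownian_motion M W" and "0 \<le> s" "0 \<le> t"
  shows "(\<integral>\<omega>. W s \<omega> * W t \<omega> \<partial>M) = min s t"
proof (cases s t rule: linorder_cases)
  case less
  then show ?thesis using brownian_covariance_less[OF B, of s t] assms by simp
next
  case equal
  then show ?thesis using brownian_moments[OF B, of t] assms by (simp add: power2_eq_square)
next
  case greater
  then show ?thesis using brownian_covariance_less[OF B, of t s] assms by (simp add: mult.commute)
qed

lemma mean_var_cong:
  assumes "\<And>\<omega>. \<omega> \<in> space M \<Longrightarrow> R \<omega> = R' \<omega>"
  shows "mean_var M c R = mean_var M c R'"
proof -
  have "(\<integral>\<omega>. R \<omega> \<partial>M) = (\<integral>\<omega>. R' \<omega> \<partial>M)"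
    by (rule Bochner_Integration.integral_cong) (use assms in auto)
  moreover from this have "(\<integral>\<omega>. (R \<omega> - (\<integral>\<omega>. R \<omega> \<partial>M))\<^sup>2 \<partial>M) = (\<integral>\<omega>. (R' \<omega> - (\<integral>\<omega>. R' \<omega> \<partial>M))\<^sup>2 \<partial>M)"
    by (intro Bochner_Integration.integral_cong) (use assms in auto)
  ultimately show ?thesis by (simp add: mean_var_def)
qed

lemma mean_var_affine:
  assumes "prob_space M" "integrable M Z" "(\<integral>\<omega>. Z \<omega> \<partial>M) = 0"
  shows "mean_var M a (\<lambda>\<omega>. - (c * Z \<omega>) - d) = - d - a / 2 * (c\<^sup>2 * (\<integral>\<omega>. (Z \<omega>)\<^sup>2 \<partial>M))"
proof -
  interpret prob_space M by fact
  have "expectation (\<lambda>\<omega>. - (c * Z \<omega>) - d) = - d"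
    using assms by (simp add: prob_space)
  then show ?thesis unfolding mean_var_def by (simp add: power_mult_distrib)
qed

context horizon
begin

section \<open>Time integrals of Brownian paths\<close>

text \<open>Rounding time down to the grid of mesh \<open>1 / Suc k\<close> leaves countably many
  times, so the approximations are jointly measurable; continuity of each path makes them converge
  at every point. The \<open>nat\<close> in \<open>r\<close> keeps the grid times nonnegative, where
  \<open>W\<close> is measurable and continuous. Fubini in \<open>brownian_integral_moments\<close>
  rests on this.\<close>

lemma brownian_pair_measurable:
  assumes B: "brownian_motion M W"
  shows "(\<lambda>(t, \<omega>). W t \<omega>) \<in> borel_measurable (N \<Otimes>\<^sub>M M)"
proof (rule borel_measurable_LIMSEQ_real)
  define r where "r = (\<lambda>(k::nat) (t::real). real (nat \<lfloor>t * real (Suc k)\<rfloor>) / real (Suc k))"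
  show "(\<lambda>(t, \<omega>). W (r k t) \<omega>) \<in> borel_measurable (N \<Otimes>\<^sub>M M)" for k
  proof -
    have "(\<lambda>x. W (real (nat \<lfloor>fst x * real (Suc k)\<rfloor>) / real (Suc k)) (snd x)) \<in> borel_measurable (N \<Otimes>\<^sub>M M)"
    proof (rule measurable_compose_countable[where f="\<lambda>m x. W (real m / real (Suc k)) (snd x)"])
      show "(\<lambda>x. W (real m / real (Suc k)) (snd x)) \<in> borel_measurable (N \<Otimes>\<^sub>M M)" for m
        using brownian_measurable[OF B, of "real m / real (Suc k)"] by measurable
      show "(\<lambda>x. nat \<lfloor>fst x * real (Suc k)\<rfloor>) \<in> N \<Otimes>\<^sub>M M \<rightarrow>\<^sub>M count_space UNIV"
        by measurable
    qed
    then show ?thesis by (simp add: r_def split_def)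
  qed
  show "(\<lambda>k. case x of (t, \<omega>) \<Rightarrow> W (r k t) \<omega>) \<longlonglongrightarrow> (case x of (t, \<omega>) \<Rightarrow> W t \<omega>)"
    if x: "x \<in> space (N \<Otimes>\<^sub>M M)" for x
  proof -
    obtain t \<omega> where [simp]: "x = (t, \<omega>)" and t: "0 \<le> t" and \<omega>: "\<omega> \<in> space M"
      using x by (cases x) (auto simp: space_pair_measure)
    have "(\<lambda>k. r k t) \<longlonglongrightarrow> t"
    proof (rule LIMSEQ_offset[where k=0], rule tendsto_sandwich)
      show "\<forall>\<^sub>F k in sequentially. t - 1 / real (Suc k) \<le> r (k + 0) t"
      proof (rule always_eventually, rule allI)
        fix k
        have "t * real (Suc k) - 1 \<le> real_of_int \<lfloor>t * real (Suc k)\<rfloor>" by linarith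
        then have "(t * real (Suc k) - 1) / real (Suc k) \<le> real_of_int \<lfloor>t * real (Suc k)\<rfloor> / real (Suc k)"
          by (rule divide_right_mono) simp
        then show "t - 1 / real (Suc k) \<le> r (k + 0) t" using t
          by (simp add: r_def diff_divide_distrib)
      qed
      show "\<forall>\<^sub>F k in sequentially. r (k + 0) t \<le> t"
      proof (rule always_eventually, rule allI)
        fix k
        have "real_of_int \<lfloor>t * real (Suc k)\<rfloor> / real (Suc k) \<le> (t * real (Suc k)) / real (Suc k)"
          by (rule divide_right_mono) auto
        then show "r (k + 0) t \<le> t" using t by (simp add: r_def)
      qed
      show "(\<lambda>k. t - 1 / real (Suc k)) \<longlonglongrightarrow> t"
        using tendsto_diff[OF tendsto_const LIMSEQ_Suc[OF lim_1_over_n], of t] by simp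
    qed simp
    moreover have "continuous_on {0..} (\<lambda>t. W t \<omega>)"
      using B \<omega> by (auto simp: brownian_motion_def)
    moreover have "r k t \<in> {0..}" for k by (simp add: r_def)
    ultimately have "(\<lambda>k. W (r k t) \<omega>) \<longlonglongrightarrow> W t \<omega>"
      using t by (auto intro: continuous_on_tendsto_compose)
    then show ?thesis by simp
  qed
qed

text \<open>Written as a primitive, the Brownian covariance becomes accessible to
  \<open>prim_by_parts\<close>.\<close>

lemma min_eq_prim:
  assumes "s \<in> {0..T}" "t \<in> {0..T}"
  shows "min s t = prim (indicator {..s}) t"
  using assms
  by (subst prim_eq_set_integral[symmetric, OF assms(2)])
    (auto simp: set_lebesgue_integral_def indicator_inter_arith[symmetric] min_def
      Int_atLeastAtMostL2 Int_absorb2)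

text \<open>The left-hand side is the variance of \<open>\<integral>y W dt\<close>; it replaces the Ito isometry.\<close>

lemma double_integral_min:
  assumes y: "integrable N y" and Y: "\<And>t. t \<in> {0..T} \<Longrightarrow> Y t = c + prim y t" and YT: "Y T = 0"
  shows "(\<integral>s. y s * (\<integral>t. y t * min s t \<partial>N) \<partial>N) = (\<integral>t. (Y t)\<^sup>2 \<partial>N)"
proof -
  have yT: "(\<integral>t. y t \<partial>N) = - c" using Y[of T] YT T_pos by (simp add: prim_T)
  have prim_sq: "sq_int (prim y)" by (rule sq_int_prim[OF y])
  have Ysq: "sq_int Y"
    by (rule sq_int_cong[OF sq_int_add[OF sq_int_const prim_sq]]) (simp add: Y)
  have Yi: "integrable N Y" by (rule sq_int_integrable[OF Ysq])
  \<comment> \<open>The covariance is the Green function of \<open>- u'' = y\<close> with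
    \<open>u 0 = 0\<close> and \<open>u' T = 0\<close>. Since \<open>Y T = 0\<close>, this forces
    \<open>u' = - Y\<close>.\<close>
  have inner: "(\<integral>t. y t * min s t \<partial>N) = - prim Y s" if s: "s \<in> {0..T}" for s
  proof -
    have ind: "integrable N (indicator {..s} :: real \<Rightarrow> real)"
      using integrable_ind_N[of "\<lambda>_. 1" "{..s}"] by simp
    have "(\<integral>t. y t * min s t \<partial>N) = (\<integral>t. y t * prim (indicator {..s}) t \<partial>N)"
      by (intro Bochner_Integration.integral_cong) (use s min_eq_prim in auto)
    also have "\<dots> = (\<integral>t. y t \<partial>N) * (\<integral>t. indicator {..s} t \<partial>N) - (\<integral>t. prim y t * indicator {..s} t \<partial>N)"
      using prim_by_parts[OF y ind] by simp
    also have "(\<integral>t. indicator {..s} t \<partial>N) = s"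
      using prim_const[OF s, of 1] by (simp add: prim_def)
    also have "(\<integral>t. prim y t * indicator {..s} t \<partial>N) = prim (prim y) s"
      by (simp add: prim_def[of "prim y"] mult.commute)
    also have "(\<integral>t. y t \<partial>N) * s - prim (prim y) s = - prim (\<lambda>t. c + prim y t) s"
      using prim_add[of "\<lambda>_. c" "prim y" s] sq_int_integrable[OF prim_sq] prim_const[OF s, of c]
      by (simp add: yT)
    also have "\<dots> = - prim Y s"
      using prim_cong[of "\<lambda>t. c + prim y t" Y s] Y by simp
    finally show ?thesis .
  qed
  have "(\<integral>s. y s * (\<integral>t. y t * min s t \<partial>N) \<partial>N) = - (\<integral>s. y s * prim Y s \<partial>N)"
    unfolding integral_minus[symmetric]
    by (intro Bochner_Integration.integral_cong) (use inner in auto)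
  also have "\<dots> = (\<integral>t. prim y t * Y t \<partial>N) + c * (\<integral>t. Y t \<partial>N)"
    using prim_by_parts[OF y Yi] yT by simp
  also have "\<dots> = (\<integral>t. prim y t * Y t + c * Y t \<partial>N)"
    using sq_int_mult[OF prim_sq Ysq] Yi by simp
  also have "\<dots> = (\<integral>t. (Y t)\<^sup>2 \<partial>N)"
    by (intro Bochner_Integration.integral_cong) (auto simp: Y power2_eq_square algebra_simps)
  finally show ?thesis .
qed

text \<open>The square of \<open>Z\<close> is an integral over pairs of times, so Fubini moves the
  expectation onto \<open>W s * W t\<close>, whose mean is the covariance. Integrability on the
  products follows from absolute moments of \<open>W\<close> that are bounded uniformly on the
  horizon (\<open>abs1\<close>, \<open>absW\<close>), multiplied by the integrable weights
  \<open>y\<close>.\<close>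

lemma brownian_integral_moments:
  assumes B: "brownian_motion M W" and y: "integrable N y"
  defines "Z \<equiv> \<lambda>\<omega>. \<integral>t. y t * W t \<omega> \<partial>N"
  shows "integrable M Z" "(\<integral>\<omega>. Z \<omega> \<partial>M) = 0"
    "(\<integral>\<omega>. (Z \<omega>)\<^sup>2 \<partial>M) = (\<integral>s. y s * (\<integral>t. y t * min s t \<partial>N) \<partial>N)"
proof -
  interpret prob_space M using assms(1) by (rule brownian_prob_space)
  interpret NM: pair_sigma_finite N M by standard
  interpret NxN: finite_measure "N \<Otimes>\<^sub>M N" by (rule finite_measure_pair_measure) (rule finite_measure_N)+
  interpret NNM: pair_sigma_finite "N \<Otimes>\<^sub>M N" M by standard
  have [measurable]: "y \<in> borel_measurable N" using y by simp
  have Wm [measurable]: "(\<lambda>x. W (fst x) (snd x)) \<in> borel_measurable (N \<Otimes>\<^sub>M M)"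
    using brownian_pair_measurable[OF B] by (simp add: split_def)
  have Wt [measurable]: "W t \<in> borel_measurable M" if "0 \<le> t" for t
    using brownian_measurable[OF B that] .
  have absW: "integrable M (\<lambda>\<omega>. \<bar>W s \<omega> * W t \<omega>\<bar>)" "(\<integral>\<omega>. \<bar>W s \<omega> * W t \<omega>\<bar> \<partial>M) \<le> T"
    if "s \<in> {0..T}" "t \<in> {0..T}" for s t
  proof -
    have st: "0 \<le> s" "0 \<le> t" "s \<le> T" "t \<le> T" using that by auto
    note ms = brownian_moments[OF B st(1)] and mt = brownian_moments[OF B st(2)]
    have le: "\<bar>a * c\<bar> \<le> (a\<^sup>2 + c\<^sup>2) / 2" for a c :: real
      using sum_squares_bound[of a c] sum_squares_bound[of "-a" c] by (simp add: abs_le_iff)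
    have i: "integrable M (\<lambda>\<omega>. ((W s \<omega>)\<^sup>2 + (W t \<omega>)\<^sup>2) / 2)" using ms mt by simp
    show j: "integrable M (\<lambda>\<omega>. \<bar>W s \<omega> * W t \<omega>\<bar>)"
      by (rule Bochner_Integration.integrable_bound[OF i]) (use le st in \<open>auto intro: order_trans\<close>)
    have "(\<integral>\<omega>. \<bar>W s \<omega> * W t \<omega>\<bar> \<partial>M) \<le> (\<integral>\<omega>. ((W s \<omega>)\<^sup>2 + (W t \<omega>)\<^sup>2) / 2 \<partial>M)"
      by (rule integral_mono[OF j i le])
    also have "\<dots> = (s + t) / 2" using ms mt by simp
    finally show "(\<integral>\<omega>. \<bar>W s \<omega> * W t \<omega>\<bar> \<partial>M) \<le> T" using st by simp
  qed
  have abs1: "(\<integral>\<omega>. \<bar>W t \<omega>\<bar> \<partial>M) \<le> 1 + T" if "t \<in> {0..T}" for t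
  proof -
    have st: "0 \<le> t" "t \<le> T" using that by auto
    note mt = brownian_moments[OF B st(1)]
    have "(\<integral>\<omega>. \<bar>W t \<omega>\<bar> \<partial>M) \<le> (\<integral>\<omega>. 1 + (W t \<omega>)\<^sup>2 \<partial>M)"
    proof (rule integral_mono)
      show "\<bar>W t \<omega>\<bar> \<le> 1 + (W t \<omega>)\<^sup>2" for \<omega>
        using sum_squares_bound[of 1 "\<bar>W t \<omega>\<bar>"] by simp
    qed (use mt in auto)
    also have "\<dots> = 1 + t" using mt by (simp add: prob_space)
    finally show ?thesis using st by simp
  qed
  have i1: "integrable (N \<Otimes>\<^sub>M M) (\<lambda>(t, \<omega>). y t * W t \<omega>)"
  proof (rule NM.Fubini_integrable)
    show "(\<lambda>(t, \<omega>). y t * W t \<omega>) \<in> borel_measurable (N \<Otimes>\<^sub>M M)"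
      unfolding split_def by measurable
    show "AE t in N. integrable M (\<lambda>\<omega>. case (t, \<omega>) of (t, \<omega>) \<Rightarrow> y t * W t \<omega>)"
      using brownian_moments(1)[OF B] by (intro AE_I2) auto
    show "integrable N (\<lambda>t. \<integral>\<omega>. norm (case (t, \<omega>) of (t, \<omega>) \<Rightarrow> y t * W t \<omega>) \<partial>M)"
    proof (rule Bochner_Integration.integrable_bound)
      show "integrable N (\<lambda>t. (1 + T) * y t)" using y by simp
      show "(\<lambda>t. \<integral>\<omega>. norm (case (t, \<omega>) of (t, \<omega>) \<Rightarrow> y t * W t \<omega>) \<partial>M) \<in> borel_measurable N"
        unfolding split_def fst_conv snd_conv using Wm
        by (intro borel_measurable_lebesgue_integral) (simp add: split_def)
      show "AE t in N. norm (\<integral>\<omega>. norm (case (t, \<omega>) of (t, \<omega>) \<Rightarrow> y t * W t \<omega>) \<partial>M) \<le> norm ((1 + T) * y t)"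
      proof (rule AE_I2)
        fix t assume "t \<in> space N"
        then have t: "t \<in> {0..T}" by simp
        show "norm (\<integral>\<omega>. norm (case (t, \<omega>) of (t, \<omega>) \<Rightarrow> y t * W t \<omega>) \<partial>M) \<le> norm ((1 + T) * y t)"
          using mult_left_mono[OF abs1[OF t], of "\<bar>y t\<bar>"] T_pos by (simp add: abs_mult mult.commute)
      qed
    qed
  qed
  show "integrable M Z"
    unfolding Z_def using NM.integrable_snd[OF i1] by simp
  have "(\<integral>\<omega>. Z \<omega> \<partial>M) = (\<integral>t. \<integral>\<omega>. y t * W t \<omega> \<partial>M \<partial>N)"
    unfolding Z_def using NM.Fubini_integral[OF i1] by simp
  also have "\<dots> = (\<integral>t. 0 \<partial>N)"
    by (intro Bochner_Integration.integral_cong) (use brownian_moments(2)[OF B] in auto)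
  finally show "(\<integral>\<omega>. Z \<omega> \<partial>M) = 0" by simp

  have yy: "integrable (N \<Otimes>\<^sub>M N) (\<lambda>(s, t). y s * y t)"
  proof (rule NN.Fubini_integrable)
    show "integrable N (\<lambda>x. \<integral>u. norm (case (x, u) of (t, s) \<Rightarrow> y t * y s) \<partial>N)"
      using y by (simp add: abs_mult)
    show "AE x in N. integrable N (\<lambda>u. case (x, u) of (t, s) \<Rightarrow> y t * y s)"
      using y by simp
  qed measurable
  have W1 [measurable]: "(\<lambda>x. W (fst (fst x)) (snd x)) \<in> borel_measurable ((N \<Otimes>\<^sub>M N) \<Otimes>\<^sub>M M)"
    using measurable_compose[OF _ Wm, of "\<lambda>x. (fst (fst x), snd x)" "(N \<Otimes>\<^sub>M N) \<Otimes>\<^sub>M M"] by simp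
  have W2 [measurable]: "(\<lambda>x. W (snd (fst x)) (snd x)) \<in> borel_measurable ((N \<Otimes>\<^sub>M N) \<Otimes>\<^sub>M M)"
    using measurable_compose[OF _ Wm, of "\<lambda>x. (snd (fst x), snd x)" "(N \<Otimes>\<^sub>M N) \<Otimes>\<^sub>M M"] by simp
  define G where "G = (\<lambda>(p, \<omega>). (y (fst p) * W (fst p) \<omega>) * (y (snd p) * W (snd p) \<omega>))"
  have Gm [measurable]: "G \<in> borel_measurable ((N \<Otimes>\<^sub>M N) \<Otimes>\<^sub>M M)"
    unfolding G_def split_def by measurable
  have i2: "integrable ((N \<Otimes>\<^sub>M N) \<Otimes>\<^sub>M M) G"
  proof (rule NNM.Fubini_integrable[OF Gm])
    have absG: "\<bar>G (p, \<omega>)\<bar> = \<bar>y (fst p) * y (snd p)\<bar> * \<bar>W (fst p) \<omega> * W (snd p) \<omega>\<bar>" for p \<omega>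
      by (simp add: G_def abs_mult)
    show "AE p in N \<Otimes>\<^sub>M N. integrable M (\<lambda>\<omega>. G (p, \<omega>))"
    proof (rule AE_I2)
      fix p assume "p \<in> space (N \<Otimes>\<^sub>M N)"
      then have p: "fst p \<in> {0..T}" "snd p \<in> {0..T}" by (auto simp: space_pair_measure)
      then have [measurable]: "W (fst p) \<in> borel_measurable M" "W (snd p) \<in> borel_measurable M"
        by (auto intro: Wt)
      have "integrable M (\<lambda>\<omega>. W (fst p) \<omega> * W (snd p) \<omega>)"
        using absW(1)[OF p] by (subst (asm) integrable_abs_iff) auto
      then have "integrable M (\<lambda>\<omega>. (y (fst p) * y (snd p)) * (W (fst p) \<omega> * W (snd p) \<omega>))" by simp
      then show "integrable M (\<lambda>\<omega>. G (p, \<omega>))" by (simp add: G_def mult_ac)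
    qed
    show "integrable (N \<Otimes>\<^sub>M N) (\<lambda>p. \<integral>\<omega>. norm (G (p, \<omega>)) \<partial>M)"
    proof (rule Bochner_Integration.integrable_bound)
      show "integrable (N \<Otimes>\<^sub>M N) (\<lambda>p. T * (y (fst p) * y (snd p)))" using yy by (simp add: split_def)
      show "(\<lambda>p. \<integral>\<omega>. norm (G (p, \<omega>)) \<partial>M) \<in> borel_measurable (N \<Otimes>\<^sub>M N)" by measurable
      show "AE p in N \<Otimes>\<^sub>M N. norm (\<integral>\<omega>. norm (G (p, \<omega>)) \<partial>M) \<le> norm (T * (y (fst p) * y (snd p)))"
      proof (rule AE_I2)
        fix p assume "p \<in> space (N \<Otimes>\<^sub>M N)"
        then have p: "fst p \<in> {0..T}" "snd p \<in> {0..T}" by (auto simp: space_pair_measure)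
        show "norm (\<integral>\<omega>. norm (G (p, \<omega>)) \<partial>M) \<le> norm (T * (y (fst p) * y (snd p)))"
          using mult_left_mono[OF absW(2)[OF p], of "\<bar>y (fst p) * y (snd p)\<bar>"] T_pos
          by (simp add: absG abs_mult mult_ac)
      qed
    qed
  qed
  have "(\<integral>\<omega>. (Z \<omega>)\<^sup>2 \<partial>M) = (\<integral>\<omega>. \<integral>p. G (p, \<omega>) \<partial>(N \<Otimes>\<^sub>M N) \<partial>M)"
  proof (rule integral_cong_AE)
    \<comment> \<open>Splitting the pair integral into an iterated one uses integrability along the
      path, which Fubini provides for almost every path.\<close>
    have "AE \<omega> in M. integrable (N \<Otimes>\<^sub>M N) (\<lambda>p. G (p, \<omega>))"
      using NNM.AE_integrable_snd[of "\<lambda>p \<omega>. G (p, \<omega>)"] i2 by simp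
    then show "AE \<omega> in M. (Z \<omega>)\<^sup>2 = (\<integral>p. G (p, \<omega>) \<partial>(N \<Otimes>\<^sub>M N))"
    proof eventually_elim
      case (elim \<omega>)
      have "(\<integral>p. G (p, \<omega>) \<partial>(N \<Otimes>\<^sub>M N)) = (\<integral>s. \<integral>t. G ((s, t), \<omega>) \<partial>N \<partial>N)"
        by (rule NN.integral_fst'[symmetric, OF elim])
      also have "\<dots> = (Z \<omega>)\<^sup>2"
        by (simp add: G_def Z_def power2_eq_square)
      finally show ?case by simp
    qed
    show "(\<lambda>\<omega>. (Z \<omega>)\<^sup>2) \<in> borel_measurable M"
      using \<open>integrable M Z\<close> by measurable
    show "(\<lambda>\<omega>. \<integral>p. G (p, \<omega>) \<partial>(N \<Otimes>\<^sub>M N)) \<in> borel_measurable M" by measurable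
  qed
  also have "\<dots> = (\<integral>p. \<integral>\<omega>. G (p, \<omega>) \<partial>M \<partial>(N \<Otimes>\<^sub>M N))"
    using NNM.Fubini_integral[of "\<lambda>p \<omega>. G (p, \<omega>)"] i2 by simp
  also have "\<dots> = (\<integral>s. \<integral>t. \<integral>\<omega>. G ((s, t), \<omega>) \<partial>M \<partial>N \<partial>N)"
    by (rule NN.integral_fst'[symmetric]) (rule NNM.integrable_fst'[OF i2])
  also have "\<dots> = (\<integral>s. \<integral>t. y s * (y t * min s t) \<partial>N \<partial>N)"
  proof (intro Bochner_Integration.integral_cong refl)
    fix s t assume "s \<in> space N" "t \<in> space N"
    then have st: "0 \<le> s" "0 \<le> t" by auto
    have "(\<integral>\<omega>. G ((s, t), \<omega>) \<partial>M) = (\<integral>\<omega>. (y s * y t) * (W s \<omega> * W t \<omega>) \<partial>M)"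
      by (simp add: G_def mult_ac)
    also have "\<dots> = (y s * y t) * min s t"
      unfolding integral_mult_right_zero brownian_covariance[OF B st] ..
    finally show "(\<integral>\<omega>. G ((s, t), \<omega>) \<partial>M) = y s * (y t * min s t)" by simp
  qed
  also have "\<dots> = (\<integral>s. y s * (\<integral>t. y t * min s t \<partial>N) \<partial>N)" by simp
  finally show "(\<integral>\<omega>. (Z \<omega>)\<^sup>2 \<partial>M) = (\<integral>s. y s * (\<integral>t. y t * min s t \<partial>N) \<partial>N)" .
qed

end

text \<open>Young's inequality. In \<open>energy_relax_le\<close> the weight is the contraction rate
  itself, so that the dominant term pays only a factor close to 1.\<close>

lemma weighted_square_sum:
  fixes p q \<mu> :: real
  assumes "0 < \<mu>"
  shows "(p + q)\<^sup>2 \<le> (1 + \<mu>) * p\<^sup>2 + (1 + 1 / \<mu>) * q\<^sup>2"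
proof -
  have "0 \<le> (\<mu> * p - q)\<^sup>2 / \<mu>" using assms by simp
  then show ?thesis using assms by (simp add: power2_eq_square field_simps)
qed

subsection \<open>Equilibria and the first-order condition\<close>

locale market = horizon T for T +
  fixes M :: "'a measure" and W :: "real \<Rightarrow> 'a \<Rightarrow> real"
    and S0 \<sigma> \<gamma> lam :: real and b :: "real \<Rightarrow> real" and n :: nat and x \<alpha> :: "nat \<Rightarrow> real"
  assumes brownian: "brownian_motion M W"
    and lam_pos: "lam > 0"
    and b_cont: "continuous_on {0..T} b"
    and \<alpha>_nonneg: "\<And>i. i < n \<Longrightarrow> \<alpha> i \<ge> 0"
begin

definition a :: "nat \<Rightarrow> real" where "a i = \<alpha> i * \<sigma>\<^sup>2"

lemma a_nonneg: "i < n \<Longrightarrow> 0 \<le> a i"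
  by (simp add: a_def \<alpha>_nonneg)

lemma adm_det_iff:
  "adm_det c T Y y \<longleftrightarrow> Y 0 = c \<and> Y T = 0 \<and> sq_int y \<and> (\<forall>t\<in>{0..T}. Y t = c + prim y t)"
proof -
  have "\<exists>d. \<forall>t\<in>{0..T}. \<bar>Y t\<bar> \<le> d" if "sq_int y" "\<forall>t\<in>{0..T}. Y t = c + prim y t"
  proof (rule exI, rule ballI)
    fix t assume "t \<in> {0..T}"
    then show "\<bar>Y t\<bar> \<le> \<bar>c\<bar> + (\<integral>s. \<bar>y s\<bar> \<partial>N)"
      using that abs_prim_le[OF sq_int_integrable[OF that(1)], of t] by auto
  qed
  moreover have "(\<forall>t\<in>{0..T}. Y t = Y 0 + (LINT s:{0..t}|lborel. y s)) \<longleftrightarrow> (\<forall>t\<in>{0..T}. Y t = Y 0 + prim y t)"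
    by (rule ball_cong[OF refl]) (simp add: prim_eq_set_integral)
  ultimately show ?thesis
    unfolding adm_det_def set_measurable_N set_integrable_N sq_int_def by metis
qed

lemma adm_det_sq_int: "adm_det c T Y y \<Longrightarrow> sq_int y"
  by (simp add: adm_det_iff)

lemma adm_det_eq: "adm_det c T Y y \<Longrightarrow> t \<in> {0..T} \<Longrightarrow> Y t = c + prim y t"
  by (simp add: adm_det_iff)

lemma adm_det_integral:
  assumes "adm_det c T Y y" shows "(\<integral>t. y t \<partial>N) = - c"
proof -
  have "Y T = c + prim y T" using assms T_pos by (intro adm_det_eq) auto
  then show ?thesis using assms by (simp add: adm_det_iff prim_T)
qed

lemma adm_det_sq_int_pos:
  assumes "adm_det c T Y y" shows "sq_int Y"
  by (rule sq_int_cong[OF sq_int_add[OF sq_int_const sq_int_prim[OF sq_int_integrable]]])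
    (use assms in \<open>auto simp: adm_det_iff\<close>)

section \<open>The objective as a quadratic functional of the rate\<close>

text \<open>\<open>p\<close> is the price without its noise. The random part of the revenue is
  \<open>- (\<sigma> * Z)\<close> with \<open>Z\<close> the integral of the rate against
  \<open>W\<close>; it is centred, and \<open>double_integral_min\<close> turns its second moment
  into the integral of the squared position.\<close>

lemma mean_var_revenue:
  assumes adm: "\<And>j. j < n \<Longrightarrow> adm_det (x j) T (X j) (Xd j)" and i: "i < n"
  defines "p \<equiv> \<lambda>t. S0 + prim b t + \<gamma> * (\<Sum>j<n. X j t - X j 0) + lam * (\<Sum>j<n. Xd j t)"
  shows "mean_var M c (revenue W T S0 \<sigma> b \<gamma> lam n X Xd i)
    = - (\<integral>t. Xd i t * p t \<partial>N) - c / 2 * (\<sigma>\<^sup>2 * (\<integral>t. (X i t)\<^sup>2 \<partial>N))"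
proof -
  have sqX: "sq_int (X j)" "sq_int (Xd j)" if "j < n" for j
    using adm[OF that] adm_det_sq_int adm_det_sq_int_pos by auto
  have sqp: "sq_int p"
    unfolding p_def
    by (intro sq_int_add sq_int_const sq_int_cmult sq_int_sum sq_int_diff sq_int_prim
        sq_int_integrable[OF sq_int_continuous[OF b_cont]] sqX) auto
  define Z where "Z \<omega> = (\<integral>t. Xd i t * W t \<omega> \<partial>N)" for \<omega>
  have rev: "revenue W T S0 \<sigma> b \<gamma> lam n X Xd i \<omega> = - (\<sigma> * Z \<omega>) - (\<integral>t. Xd i t * p t \<partial>N)"
    if \<omega>: "\<omega> \<in> space M" for \<omega>
  proof -
    have "continuous_on {0..T} (\<lambda>t. W t \<omega>)"
      by (rule continuous_on_subset[of "{0..}"]) (use brownian \<omega> in \<open>auto simp: brownian_motion_def\<close>)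
    then have sqW: "sq_int (\<lambda>t. W t \<omega>)" by (rule sq_int_continuous)
    have "(\<integral>t. Xd i t * price W S0 \<sigma> b \<gamma> lam n X Xd t \<omega> \<partial>N)
      = (\<integral>t. \<sigma> * (Xd i t * W t \<omega>) + Xd i t * p t \<partial>N)"
      by (rule Bochner_Integration.integral_cong)
        (auto simp: price_def p_def prim_eq_set_integral algebra_simps)
    also have "\<dots> = \<sigma> * Z \<omega> + (\<integral>t. Xd i t * p t \<partial>N)"
      unfolding Z_def
      using sq_int_mult[OF sqX(2)[OF i] sqW] sq_int_mult[OF sqX(2)[OF i] sqp] by simp
    finally show ?thesis by (simp add: revenue_def set_integral_N)
  qed
  note Zm = brownian_integral_moments[OF brownian sq_int_integrable[OF sqX(2)[OF i]], folded Z_def]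
  have "(\<integral>\<omega>. (Z \<omega>)\<^sup>2 \<partial>M) = (\<integral>t. (X i t)\<^sup>2 \<partial>N)"
    unfolding Zm(3) by (rule double_integral_min[OF sq_int_integrable[OF sqX(2)[OF i]]])
      (use adm[OF i] in \<open>auto simp: adm_det_iff\<close>)
  then show ?thesis
    using mean_var_cong[of M "revenue W T S0 \<sigma> b \<gamma> lam n X Xd i", OF rev]
      mean_var_affine[OF brownian_prob_space[OF brownian] Zm(1,2)] by simp
qed

text \<open>The gradient of the cost of agent \<open>i\<close> with respect to its rate, up to
  additive constants, which mean-zero perturbations do not see. The own rate appears twice because
  its temporary impact is quadratic. The own permanent impact is subtracted because its cost depends
  only on the initial position. The term with \<open>prim (X i)\<close> is the risk term after
  integration by parts.\<close>

definition foc :: "(nat \<Rightarrow> real \<Rightarrow> real) \<Rightarrow> (nat \<Rightarrow> real \<Rightarrow> real) \<Rightarrow> nat \<Rightarrow> real \<Rightarrow> real" where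
  "foc X Xd i t = lam * (Xd i t + (\<Sum>j<n. Xd j t))
     + \<gamma> * ((\<Sum>j<n. X j t - x j) - (X i t - x i)) + prim b t - a i * prim (X i) t"

lemma sq_int_foc:
  assumes adm: "\<And>j. j < n \<Longrightarrow> adm_det (x j) T (X j) (Xd j)" and i: "i < n"
  shows "sq_int (foc X Xd i)"
proof -
  have sqX: "sq_int (X j)" "sq_int (Xd j)" if "j < n" for j
    using adm[OF that] adm_det_sq_int adm_det_sq_int_pos by auto
  show ?thesis
    unfolding foc_def[abs_def]
    by (intro sq_int_add sq_int_const sq_int_cmult sq_int_sum sq_int_diff sq_int_prim
        sq_int_integrable[OF sq_int_continuous[OF b_cont]] sq_int_integrable sqX) (use i in auto)
qed

text \<open>An exact expansion, so the linear part is found without differentiating in a function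
  space. Integration by parts moves the position term onto the rate perturbation, and the boundary
  term vanishes because \<open>e\<close> has mean zero.\<close>

lemma quadratic_functional_diff:
  fixes l d :: real
  assumes u: "sq_int u" and e: "sq_int e" and G: "sq_int G" and U: "sq_int U"
    and e0: "(\<integral>t. e t \<partial>N) = 0"
  defines "Q \<equiv> \<lambda>v V. (\<integral>t. v t * G t \<partial>N) + l * (\<integral>t. (v t)\<^sup>2 \<partial>N) + d / 2 * (\<integral>t. (V t)\<^sup>2 \<partial>N)"
  shows "Q (\<lambda>t. u t + e t) (\<lambda>t. U t + prim e t) - Q u U
    = (\<integral>t. e t * (G t + 2 * l * u t - d * prim U t) \<partial>N)
      + l * (\<integral>t. (e t)\<^sup>2 \<partial>N) + d / 2 * (\<integral>t. (prim e t)\<^sup>2 \<partial>N)"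
proof -
  have P: "sq_int (prim e)" by (rule sq_int_prim[OF sq_int_integrable[OF e]])
  have PU: "sq_int (prim U)" by (rule sq_int_prim[OF sq_int_integrable[OF U]])
  have 1: "(\<integral>t. (u t + e t) * G t \<partial>N) = (\<integral>t. u t * G t \<partial>N) + (\<integral>t. e t * G t \<partial>N)"
    using sq_int_mult[OF u G] sq_int_mult[OF e G] by (simp add: ring_distribs)
  have sq: "(\<integral>t. (f t + g t)\<^sup>2 \<partial>N) = (\<integral>t. (f t)\<^sup>2 \<partial>N) + 2 * (\<integral>t. f t * g t \<partial>N) + (\<integral>t. (g t)\<^sup>2 \<partial>N)"
    if "sq_int f" "sq_int g" for f g
  proof -
    have "(\<integral>t. (f t + g t)\<^sup>2 \<partial>N) = (\<integral>t. (f t)\<^sup>2 + 2 * (f t * g t) + (g t)\<^sup>2 \<partial>N)"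
      by (simp add: power2_sum algebra_simps)
    then show ?thesis using that sq_int_mult[OF that] by (simp add: sq_int_square)
  qed
  have 2: "(\<integral>t. U t * prim e t \<partial>N) = - (\<integral>t. e t * prim U t \<partial>N)"
    using prim_by_parts[OF sq_int_integrable[OF U] sq_int_integrable[OF e]] e0 by (simp add: mult.commute)
  have "(\<integral>t. e t * (G t + 2 * l * u t - d * prim U t) \<partial>N)
    = (\<integral>t. e t * G t + 2 * l * (u t * e t) - d * (e t * prim U t) \<partial>N)"
    by (simp add: algebra_simps)
  also have "\<dots> = (\<integral>t. e t * G t \<partial>N) + 2 * l * (\<integral>t. u t * e t \<partial>N) - d * (\<integral>t. e t * prim U t \<partial>N)"
    using sq_int_mult[OF e G] sq_int_mult[OF u e] sq_int_mult[OF e PU] by simp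
  finally show ?thesis
    unfolding Q_def 1 sq[OF u e] sq[OF U P] 2 by (simp add: algebra_simps)
qed

text \<open>The other agents enter the cost of agent \<open>i\<close> only through the fixed
  function \<open>G\<close>, so a deviation changes a quadratic functional of the own rate and
  \<open>quadratic_functional_diff\<close> applies.\<close>

lemma mean_var_diff:
  assumes adm: "\<And>j. j < n \<Longrightarrow> adm_det (x j) T (X j) (Xd j)" and i: "i < n"
    and Y: "adm_det (x i) T Y y"
  defines "e \<equiv> \<lambda>t. y t - Xd i t"
  shows "mean_var M (\<alpha> i) (revenue W T S0 \<sigma> b \<gamma> lam n (X(i := Y)) (Xd(i := y)) i)
     - mean_var M (\<alpha> i) (revenue W T S0 \<sigma> b \<gamma> lam n X Xd i)
   = - ((\<integral>t. e t * foc X Xd i t \<partial>N) + lam * (\<integral>t. (e t)\<^sup>2 \<partial>N) + a i / 2 * (\<integral>t. (prim e t)\<^sup>2 \<partial>N))"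
proof -
  have sqX: "sq_int (X j)" "sq_int (Xd j)" if "j < n" for j
    using adm[OF that] adm_det_sq_int adm_det_sq_int_pos by auto
  have X0: "X j 0 = x j" if "j < n" for j using adm[OF that] by (simp add: adm_det_iff)
  define R where "R = {..<n} - {i}"
  define G where "G = (\<lambda>t. S0 + prim b t + \<gamma> * (\<Sum>j\<in>R. X j t - x j) + lam * (\<Sum>j\<in>R. Xd j t))"
  define Q where "Q = (\<lambda>v V. (\<integral>t. v t * G t \<partial>N) + lam * (\<integral>t. (v t)\<^sup>2 \<partial>N) + a i / 2 * (\<integral>t. (V t)\<^sup>2 \<partial>N))"
  have sqG: "sq_int G"
    unfolding G_def
    by (intro sq_int_add sq_int_const sq_int_cmult sq_int_sum sq_int_diff sq_int_prim
        sq_int_integrable[OF sq_int_continuous[OF b_cont]] sqX) (auto simp: R_def)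
  have split: "(\<Sum>j<n. f j) = f i + (\<Sum>j\<in>R. f j)" for f :: "nat \<Rightarrow> real"
    unfolding R_def using i by (subst sum.remove[of _ i]) auto
  have J: "mean_var M (\<alpha> i) (revenue W T S0 \<sigma> b \<gamma> lam n (X(i := V)) (Xd(i := v)) i)
    = - Q v V - \<gamma> * ((x i)\<^sup>2 / 2)" if V: "adm_det (x i) T V v" for V v
  proof -
    have adm': "adm_det (x j) T ((X(i := V)) j) ((Xd(i := v)) j)" if "j < n" for j
      using V adm[OF that] by simp
    have sqv: "sq_int v" "sq_int V" using V adm_det_sq_int adm_det_sq_int_pos by auto
    have V0: "V 0 = x i" using V by (simp add: adm_det_iff)
    \<comment> \<open>The cost of the own permanent impact is the same for every admissible strategy
      and cancels in the comparison.\<close>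
    have vv: "(\<integral>t. v t * prim v t \<partial>N) = (x i)\<^sup>2 / 2"
      using prim_by_parts[OF sq_int_integrable[OF sqv(1)] sq_int_integrable[OF sqv(1)]] adm_det_integral[OF V]
      by (simp add: mult.commute power2_eq_square)
    have "(\<integral>t. v t * (S0 + prim b t + \<gamma> * (\<Sum>j<n. (X(i := V)) j t - (X(i := V)) j 0) + lam * (\<Sum>j<n. (Xd(i := v)) j t)) \<partial>N)
      = (\<integral>t. v t * G t + \<gamma> * (v t * prim v t) + lam * (v t)\<^sup>2 \<partial>N)"
    proof (rule Bochner_Integration.integral_cong[OF refl])
      fix t assume "t \<in> space N"
      then have Vt: "V t = x i + prim v t" using adm_det_eq[OF V] by simp
      have "(\<Sum>j<n. (X(i := V)) j t - (X(i := V)) j 0) = prim v t + (\<Sum>j\<in>R. X j t - x j)"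
        unfolding split by (simp add: V0 Vt) (auto simp: R_def X0 intro!: sum.cong)
      moreover have "(\<Sum>j<n. (Xd(i := v)) j t) = v t + (\<Sum>j\<in>R. Xd j t)"
        unfolding split by simp (auto simp: R_def intro!: sum.cong)
      ultimately show "v t * (S0 + prim b t + \<gamma> * (\<Sum>j<n. (X(i := V)) j t - (X(i := V)) j 0) + lam * (\<Sum>j<n. (Xd(i := v)) j t))
        = v t * G t + \<gamma> * (v t * prim v t) + lam * (v t)\<^sup>2"
        by (simp add: G_def algebra_simps power2_eq_square)
    qed
    also have "\<dots> = (\<integral>t. v t * G t \<partial>N) + \<gamma> * ((x i)\<^sup>2 / 2) + lam * (\<integral>t. (v t)\<^sup>2 \<partial>N)"
      using sq_int_mult[OF sqv(1) sqG] sq_int_mult[OF sqv(1) sq_int_prim[OF sq_int_integrable[OF sqv(1)]]]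
        sq_int_square[OF sqv(1)] vv by simp
    finally show ?thesis
      using mean_var_revenue[of "X(i := V)" "Xd(i := v)", OF adm' i, of "\<alpha> i"] by (simp add: Q_def a_def)
  qed
  have sqy: "sq_int y" by (rule adm_det_sq_int[OF Y])
  have sqe: "sq_int e" unfolding e_def by (rule sq_int_diff[OF sqy sqX(2)[OF i]])
  have e0: "(\<integral>t. e t \<partial>N) = 0"
    using adm_det_integral[OF Y] adm_det_integral[OF adm[OF i]] sq_int_integrable[OF sqy] sq_int_integrable[OF sqX(2)[OF i]]
    by (simp add: e_def)
  have "Q y Y = Q (\<lambda>t. Xd i t + e t) (\<lambda>t. X i t + prim e t)"
  proof -
    have "(\<integral>t. (Y t)\<^sup>2 \<partial>N) = (\<integral>t. (X i t + prim e t)\<^sup>2 \<partial>N)"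
      by (rule Bochner_Integration.integral_cong[OF refl])
        (simp add: adm_det_eq[OF Y] adm_det_eq[OF adm[OF i]] e_def
          prim_diff[OF sq_int_integrable[OF sqy] sq_int_integrable[OF sqX(2)[OF i]]])
    then show ?thesis by (simp add: Q_def e_def)
  qed
  then have Qd: "Q y Y - Q (Xd i) (X i) = (\<integral>t. e t * (G t + 2 * lam * Xd i t - a i * prim (X i) t) \<partial>N)
      + lam * (\<integral>t. (e t)\<^sup>2 \<partial>N) + a i / 2 * (\<integral>t. (prim e t)\<^sup>2 \<partial>N)"
    unfolding Q_def using quadratic_functional_diff[OF sqX(2)[OF i] sqe sqG sqX(1)[OF i] e0, of lam "a i"] by simp
  have foc_eq: "G t + 2 * lam * Xd i t - a i * prim (X i) t = S0 + foc X Xd i t" for t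
    unfolding G_def foc_def split by (simp add: algebra_simps)
  have "(\<integral>t. e t * (S0 + foc X Xd i t) \<partial>N) = (\<integral>t. S0 * e t + e t * foc X Xd i t \<partial>N)"
    by (simp add: algebra_simps)
  also have "\<dots> = (\<integral>t. e t * foc X Xd i t \<partial>N)"
    using sq_int_mult[OF sqe sq_int_foc[of X Xd, OF adm i]] sq_int_integrable[OF sqe] e0 by simp
  finally have "(\<integral>t. e t * (S0 + foc X Xd i t) \<partial>N) = (\<integral>t. e t * foc X Xd i t \<partial>N)" .
  then show ?thesis using Qd J[OF Y] J[OF adm[OF i]] unfolding foc_eq by simp
qed

lemma integral_square_zero_AE:
  assumes "sq_int f" "(\<integral>t. (f t)\<^sup>2 \<partial>N) = 0"
  shows "AE t in N. f t = 0"
  using integral_nonneg_eq_0_iff_AE[OF sq_int_square[OF assms(1)]] assms(2) by simp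

text \<open>Necessity is the du Bois-Reymond argument, with the deviation \<open>h\<close> of
  \<open>foc\<close> from its mean as test function. Sufficiency is concavity: in
  \<open>mean_var_diff\<close> a constant \<open>foc\<close> annihilates the linear term, and the
  quadratic terms have a sign.\<close>

lemma nash_iff_foc:
  "nash_mv M W T S0 \<sigma> b \<gamma> lam n x \<alpha> X Xd \<longleftrightarrow>
    (\<forall>i<n. adm_det (x i) T (X i) (Xd i)) \<and> (\<forall>i<n. \<exists>c. AE t in N. foc X Xd i t = c)"
proof (cases "\<forall>i<n. adm_det (x i) T (X i) (Xd i)")
  case False
  then show ?thesis by (auto simp: nash_mv_def)
next
  case True
  then have adm: "\<And>j. j < n \<Longrightarrow> adm_det (x j) T (X j) (Xd j)" by simp
  have sqX: "sq_int (X j)" "sq_int (Xd j)" if "j < n" for j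
    using adm[OF that] adm_det_sq_int adm_det_sq_int_pos by auto
  define Dv where "Dv = (\<lambda>i e. (\<integral>t. e t * foc X Xd i t \<partial>N) + lam * (\<integral>t. (e t)\<^sup>2 \<partial>N) + a i / 2 * (\<integral>t. (prim e t)\<^sup>2 \<partial>N))"
  have "(\<forall>Y Yd. adm_det (x i) T Y Yd \<longrightarrow>
        mean_var M (\<alpha> i) (revenue W T S0 \<sigma> b \<gamma> lam n (X(i := Y)) (Xd(i := Yd)) i)
        \<le> mean_var M (\<alpha> i) (revenue W T S0 \<sigma> b \<gamma> lam n X Xd i))
    \<longleftrightarrow> (\<exists>c. AE t in N. foc X Xd i t = c)" (is "?L \<longleftrightarrow> ?R") if i: "i < n" for i
  proof
    assume L: ?L
    have pos: "0 \<le> Dv i e" if e: "sq_int e" and e0: "(\<integral>t. e t \<partial>N) = 0" for e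
    proof -
      have "adm_det (x i) T (\<lambda>t. X i t + prim e t) (\<lambda>t. Xd i t + e t)"
        using adm[OF i] e sqX[OF i]
        by (auto simp: adm_det_iff prim_0 prim_T e0 prim_add sq_int_integrable intro: sq_int_add)
      from mean_var_diff[OF adm i this] L[rule_format, OF this] show ?thesis
        by (simp add: Dv_def)
    qed
    define c where "c = (\<integral>t. foc X Xd i t \<partial>N) / T"
    define h where "h = (\<lambda>t. foc X Xd i t - c)"
    have sqf: "sq_int (foc X Xd i)" by (rule sq_int_foc[OF adm i])
    have sqh: "sq_int h" unfolding h_def by (intro sq_int_diff sqf sq_int_const)
    have h0: "(\<integral>t. h t \<partial>N) = 0"
      using T_pos sq_int_integrable[OF sqf] by (simp add: h_def c_def)
    have hf: "(\<integral>t. h t * foc X Xd i t \<partial>N) = (\<integral>t. (h t)\<^sup>2 \<partial>N)"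
    proof -
      have "(\<integral>t. h t * foc X Xd i t \<partial>N) = (\<integral>t. (h t)\<^sup>2 + c * h t \<partial>N)"
        by (intro Bochner_Integration.integral_cong) (auto simp: h_def power2_eq_square algebra_simps)
      then show ?thesis using sq_int_square[OF sqh] sq_int_integrable[OF sqh] h0 by simp
    qed
    define A where "A = (\<integral>t. (h t)\<^sup>2 \<partial>N)"
    define C where "C = lam * A + a i / 2 * (\<integral>t. (prim h t)\<^sup>2 \<partial>N)"
    have A: "0 \<le> A" by (simp add: A_def)
    have C: "0 \<le> C" using lam_pos a_nonneg[OF i] A by (simp add: C_def)
    \<comment> \<open>Perturbing by \<open>-r h\<close> changes the objective by \<open>r A - r\<^sup>2 C\<close>, which forces \<open>A = 0\<close>.\<close>
    have step: "A \<le> r * C" if "r > 0" for r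
    proof -
      have "Dv i (\<lambda>t. - r * h t) = - r * A + r\<^sup>2 * C"
        unfolding Dv_def prim_cmult power_mult_distrib mult.assoc integral_mult_right_zero hf
        by (simp add: A_def C_def algebra_simps)
      moreover have "0 \<le> Dv i (\<lambda>t. - r * h t)"
        by (rule pos[OF sq_int_cmult[OF sqh]]) (simp add: h0)
      ultimately have "r * A \<le> r * (r * C)" by (simp add: power2_eq_square)
      then show ?thesis using that by simp
    qed
    have "A = 0"
    proof (rule ccontr)
      assume "A \<noteq> 0"
      with A have "A > 0" by simp
      with step[of "A / (2 * (C + 1))"] C have "A \<le> A / (2 * (C + 1)) * C" by simp
      also have "\<dots> < A" using \<open>A > 0\<close> C by (simp add: field_simps add_nonneg_pos)
      finally show False by simp
    qed
    then have "AE t in N. h t = 0" unfolding A_def by (rule integral_square_zero_AE[OF sqh])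
    then have "AE t in N. foc X Xd i t = c" by (auto simp: h_def elim: eventually_mono)
    then show ?R by blast
  next
    assume ?R
    then obtain c where c: "AE t in N. foc X Xd i t = c" by blast
    show ?L
    proof (intro allI impI)
      fix Y y assume Y: "adm_det (x i) T Y y"
      define e where "e = (\<lambda>t. y t - Xd i t)"
      have sqy: "sq_int y" by (rule adm_det_sq_int[OF Y])
      have sqe: "sq_int e" unfolding e_def by (rule sq_int_diff[OF sqy sqX(2)[OF i]])
      have e0: "(\<integral>t. e t \<partial>N) = 0"
        using adm_det_integral[OF Y] adm_det_integral[OF adm[OF i]] sq_int_integrable[OF sqy] sq_int_integrable[OF sqX(2)[OF i]]
        by (simp add: e_def)
      have "(\<integral>t. e t * foc X Xd i t \<partial>N) = (\<integral>t. e t * c \<partial>N)"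
        by (rule integral_cong_AE)
          (use c sq_int_mult[OF sqe sq_int_foc[of X Xd, OF adm i]] sq_int_measurable[OF sqe] in \<open>auto elim: eventually_mono\<close>)
      also have "\<dots> = 0" using e0 by simp
      finally have "0 \<le> Dv i e" using lam_pos a_nonneg[OF i] by (simp add: Dv_def)
      then show "mean_var M (\<alpha> i) (revenue W T S0 \<sigma> b \<gamma> lam n (X(i := Y)) (Xd(i := y)) i)
        \<le> mean_var M (\<alpha> i) (revenue W T S0 \<sigma> b \<gamma> lam n X Xd i)"
        using mean_var_diff[OF adm i Y] by (simp add: Dv_def e_def)
    qed
  qed
  then show ?thesis using True by (auto simp: nash_mv_def)
qed

section \<open>Uniqueness of equilibria\<close>

text \<open>The Volterra operator \<open>K\<close> of the overview: the change of \<open>foc\<close>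
  that a change \<open>w\<close> of the rates causes through the positions.\<close>

definition coupling :: "(nat \<Rightarrow> real \<Rightarrow> real) \<Rightarrow> nat \<Rightarrow> real \<Rightarrow> real" where
  "coupling w i t = \<gamma> * (prim (\<lambda>t. \<Sum>j<n. w j t) t - prim (w i) t) - a i * prim (prim (w i)) t"

lemma sq_int_coupling:
  assumes "\<And>j. j < n \<Longrightarrow> sq_int (w j)" and i: "i < n"
  shows "sq_int (coupling w i)"
  unfolding coupling_def[abs_def]
  by (intro sq_int_cmult sq_int_diff sq_int_prim sq_int_integrable sq_int_sum assms) auto

text \<open>The permanent impact contributes only the boundary terms \<open>(\<integral>w)\<^sup>2 / 2\<close>, which vanish.\<close>

lemma coupling_accretive:
  assumes w: "\<And>j. j < n \<Longrightarrow> sq_int (w j)" and w0: "\<And>j. j < n \<Longrightarrow> (\<integral>t. w j t \<partial>N) = 0"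
  shows "0 \<le> (\<Sum>i<n. \<integral>t. w i t * coupling w i t \<partial>N)"
proof -
  define s where "s = (\<lambda>t. \<Sum>j<n. w j t)"
  have sqs: "sq_int s" unfolding s_def by (rule sq_int_sum) (use w in auto)
  have s0: "(\<integral>t. s t \<partial>N) = 0" unfolding s_def using w w0
    by (subst Bochner_Integration.integral_sum) (auto intro: sq_int_integrable)
  have self: "(\<integral>t. f t * prim f t \<partial>N) = 0" if "sq_int f" "(\<integral>t. f t \<partial>N) = 0" for f
    using prim_by_parts[OF sq_int_integrable[OF that(1)] sq_int_integrable[OF that(1)]] that(2)
    by (simp add: mult.commute)
  have P: "sq_int (prim f)" if "sq_int f" for f
    by (rule sq_int_prim[OF sq_int_integrable[OF that]])
  have each: "(\<integral>t. w i t * coupling w i t \<partial>N) = \<gamma> * (\<integral>t. w i t * prim s t \<partial>N) + a i * (\<integral>t. (prim (w i) t)\<^sup>2 \<partial>N)"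
    if i: "i < n" for i
  proof -
    note wi = w[OF i] and wi0 = w0[OF i]
    have "(\<integral>t. w i t * coupling w i t \<partial>N)
      = (\<integral>t. \<gamma> * (w i t * prim s t) - \<gamma> * (w i t * prim (w i) t) - a i * (w i t * prim (prim (w i)) t) \<partial>N)"
      by (simp add: coupling_def s_def algebra_simps)
    also have "\<dots> = \<gamma> * (\<integral>t. w i t * prim s t \<partial>N) - a i * (\<integral>t. w i t * prim (prim (w i)) t \<partial>N)"
      using sq_int_mult[OF wi P[OF sqs]] sq_int_mult[OF wi P[OF wi]] sq_int_mult[OF wi P[OF P[OF wi]]]
        self[OF wi wi0] by simp
    also have "(\<integral>t. w i t * prim (prim (w i)) t \<partial>N) = - (\<integral>t. (prim (w i) t)\<^sup>2 \<partial>N)"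
      using prim_by_parts[OF sq_int_integrable[OF wi] sq_int_integrable[OF P[OF wi]]] wi0
      by (simp add: power2_eq_square)
    finally show ?thesis by simp
  qed
  have "(\<Sum>i<n. \<integral>t. w i t * coupling w i t \<partial>N)
      = \<gamma> * (\<Sum>i<n. \<integral>t. w i t * prim s t \<partial>N) + (\<Sum>i<n. a i * (\<integral>t. (prim (w i) t)\<^sup>2 \<partial>N))"
    by (simp add: each sum.distrib sum_distrib_left)
  also have "(\<Sum>i<n. \<integral>t. w i t * prim s t \<partial>N) = (\<integral>t. s t * prim s t \<partial>N)"
    using Bochner_Integration.integral_sum[of "{..<n}" N "\<lambda>i t. w i t * prim s t"] sq_int_mult[OF w P[OF sqs]]
    by (simp add: sum_distrib_right[symmetric] s_def[THEN fun_cong, symmetric])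
  also have "\<dots> = 0" by (rule self[OF sqs s0])
  finally show ?thesis using a_nonneg by (auto intro!: sum_nonneg)
qed

lemma nash_unique:
  assumes X: "nash_mv M W T S0 \<sigma> b \<gamma> lam n x \<alpha> X Xd" and Y: "nash_mv M W T S0 \<sigma> b \<gamma> lam n x \<alpha> Y Yd"
    and "i < n" "t \<in> {0..T}"
  shows "Y i t = X i t"
proof -
  have admX: "\<And>j. j < n \<Longrightarrow> adm_det (x j) T (X j) (Xd j)"
    and admY: "\<And>j. j < n \<Longrightarrow> adm_det (x j) T (Y j) (Yd j)"
    using X Y by (auto simp: nash_mv_def)
  define e where "e = (\<lambda>j t. Yd j t - Xd j t)"
  define s where "s = (\<lambda>t. \<Sum>j<n. e j t)"
  have sqX: "sq_int (X j)" "sq_int (Xd j)" "sq_int (Y j)" "sq_int (Yd j)" if "j < n" for j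
    using admX[OF that] admY[OF that] adm_det_sq_int adm_det_sq_int_pos by auto
  have sqe: "sq_int (e j)" if "j < n" for j
    unfolding e_def using sqX[OF that] by (intro sq_int_diff)
  have sqs: "sq_int s" unfolding s_def by (rule sq_int_sum) (use sqe in auto)
  have e0: "(\<integral>t. e j t \<partial>N) = 0" if "j < n" for j
    using adm_det_integral[OF admX[OF that]] adm_det_integral[OF admY[OF that]] sqX[OF that]
    by (simp add: e_def sq_int_integrable)
  have diff: "Y j t - X j t = prim (e j) t" if "j < n" "t \<in> {0..T}" for j t
    using adm_det_eq[OF admX[OF that(1)] that(2)] adm_det_eq[OF admY[OF that(1)] that(2)]
    by (simp add: e_def prim_diff sq_int_integrable[OF sqX(2)[OF that(1)]] sq_int_integrable[OF sqX(4)[OF that(1)]])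
  have foc_diff: "foc Y Yd j t - foc X Xd j t = lam * (e j t + s t) + coupling e j t"
    if j: "j < n" and t: "t \<in> {0..T}" for j t
  proof -
    have 1: "(\<Sum>k<n. Y k t - x k) - (\<Sum>k<n. X k t - x k) = prim s t"
      unfolding s_def
      by (subst prim_sum) (auto simp: sum_subtractf[symmetric] diff[OF _ t] intro!: sum.cong sqe sq_int_integrable)
    have 2: "prim (Y j) t - prim (X j) t = prim (prim (e j)) t"
      using prim_diff[OF sq_int_integrable[OF sqX(3)[OF j]] sq_int_integrable[OF sqX(1)[OF j]], of t]
        prim_cong[of "\<lambda>t. Y j t - X j t" "prim (e j)" t] diff[OF j] by simp
    have 3: "(\<Sum>k<n. Yd k t) - (\<Sum>k<n. Xd k t) = s t"
      by (simp add: s_def e_def sum_subtractf)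
    have "foc Y Yd j t - foc X Xd j t = lam * ((Yd j t - Xd j t) + ((\<Sum>k<n. Yd k t) - (\<Sum>k<n. Xd k t)))
      + \<gamma> * (((\<Sum>k<n. Y k t - x k) - (\<Sum>k<n. X k t - x k)) - (Y j t - X j t)) - a j * (prim (Y j) t - prim (X j) t)"
      by (simp add: foc_def algebra_simps)
    then show ?thesis unfolding 1 2 3 diff[OF j t] by (simp add: coupling_def e_def s_def)
  qed
  \<comment> \<open>Both \<open>foc\<close> are constant almost everywhere, so their difference is
    orthogonal to the mean-zero \<open>e j\<close>; \<open>foc_diff\<close> expands that
    difference.\<close>
  have zero: "lam * (\<integral>t. (e j t)\<^sup>2 \<partial>N) + lam * (\<integral>t. e j t * s t \<partial>N) + (\<integral>t. e j t * coupling e j t \<partial>N) = 0"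
    if j: "j < n" for j
  proof -
    note ej = sqe[OF j]
    obtain c d where c: "AE t in N. foc X Xd j t = c" and d: "AE t in N. foc Y Yd j t = d"
      using X Y j unfolding nash_iff_foc by blast
    have i1: "integrable N (\<lambda>t. lam * (e j t)\<^sup>2 + lam * (e j t * s t) + e j t * coupling e j t)"
      using sq_int_square[OF ej] sq_int_mult[OF ej sqs] sq_int_mult[OF ej sq_int_coupling[of e, OF sqe j]] by simp
    have "(\<integral>t. lam * (e j t)\<^sup>2 + lam * (e j t * s t) + e j t * coupling e j t \<partial>N) = (\<integral>t. e j t * (d - c) \<partial>N)"
    proof (rule integral_cong_AE)
      show "AE t in N. lam * (e j t)\<^sup>2 + lam * (e j t * s t) + e j t * coupling e j t = e j t * (d - c)"
        using c d AE_space
      proof eventually_elim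
        case (elim t)
        then have "d - c = lam * (e j t + s t) + coupling e j t"
          using foc_diff[OF j, of t] by simp
        then show ?case by (simp add: algebra_simps power2_eq_square)
      qed
    qed (use i1 sq_int_measurable[OF ej] in auto)
    also have "\<dots> = 0" using e0[OF j] by simp
    finally show ?thesis
      using sq_int_square[OF ej] sq_int_mult[OF ej sqs] sq_int_mult[OF ej sq_int_coupling[of e, OF sqe j]] by simp
  qed
  have sum0: "lam * (\<Sum>j<n. \<integral>t. (e j t)\<^sup>2 \<partial>N) + lam * (\<Sum>j<n. \<integral>t. e j t * s t \<partial>N) + (\<Sum>j<n. \<integral>t. e j t * coupling e j t \<partial>N) = 0"
    using zero by (simp add: sum_distrib_left sum.distrib[symmetric])
  \<comment> \<open>Summed over the agents, the cross terms of the temporary impact form a square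
    and are therefore nonnegative.\<close>
  have es: "(\<Sum>j<n. \<integral>t. e j t * s t \<partial>N) = (\<integral>t. (s t)\<^sup>2 \<partial>N)"
    using Bochner_Integration.integral_sum[of "{..<n}" N "\<lambda>i t. e i t * s t"] sq_int_mult[OF sqe sqs]
    by (simp add: sum_distrib_right[symmetric] s_def[THEN fun_cong, symmetric] power2_eq_square)
  have "0 \<le> (\<Sum>j<n. \<integral>t. e j t * coupling e j t \<partial>N)"
    by (rule coupling_accretive[OF sqe e0])
  moreover have "0 \<le> lam * (\<integral>t. (s t)\<^sup>2 \<partial>N)" using lam_pos by simp
  ultimately have "lam * (\<Sum>j<n. \<integral>t. (e j t)\<^sup>2 \<partial>N) \<le> 0"
    using sum0 unfolding es by linarith
  then have "(\<Sum>j<n. \<integral>t. (e j t)\<^sup>2 \<partial>N) \<le> 0" using lam_pos by (simp add: mult_le_0_iff)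
  then have "(\<Sum>j<n. \<integral>t. (e j t)\<^sup>2 \<partial>N) = 0"
    by (intro antisym sum_nonneg) auto
  then have "(\<integral>t. (e i t)\<^sup>2 \<partial>N) = 0" using \<open>i < n\<close>
    by (subst (asm) sum_nonneg_eq_0_iff) auto
  then have "AE t in N. e i t = 0" by (rule integral_square_zero_AE[OF sqe[OF \<open>i < n\<close>]])
  \<comment> \<open>The rates agree only almost everywhere, which is enough for the positions to
    agree at every time.\<close>
  then have "prim (e i) t = prim (\<lambda>_. 0) t"
    using sq_int_measurable[OF sqe[OF \<open>i < n\<close>]] by (intro prim_cong_AE) auto
  then show ?thesis using diff[OF \<open>i < n\<close> \<open>t \<in> {0..T}\<close>] by (simp add: prim_def)
qed

section \<open>From the boundary value problem to equilibria\<close>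

text \<open>Differentiating \<open>foc\<close> in time returns the residual of the differential
  equation, so \<open>foc\<close> is constant on the whole interval.\<close>

lemma bvp_imp_nash:
  assumes "solves_bvp T \<sigma> b \<gamma> lam n x \<alpha> X"
  shows "\<exists>Xd. nash_mv M W T S0 \<sigma> b \<gamma> lam n x \<alpha> X Xd"
proof -
  from assms obtain X1 X2 where
    bd: "\<And>i. i < n \<Longrightarrow> X i 0 = x i \<and> X i T = 0" and
    d1: "\<And>i t. i < n \<Longrightarrow> t \<in> {0..T} \<Longrightarrow> (X i has_real_derivative X1 i t) (at t within {0..T})" and
    d2: "\<And>i t. i < n \<Longrightarrow> t \<in> {0..T} \<Longrightarrow> (X1 i has_real_derivative X2 i t) (at t within {0..T})" and
    ode: "\<And>i t. i < n \<Longrightarrow> t \<in> {0..T} \<Longrightarrow> \<alpha> i * \<sigma>\<^sup>2 * X i t - 2 * lam * X2 i t =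
               b t + \<gamma> * (\<Sum>j\<in>{..<n} - {i}. X1 j t) + lam * (\<Sum>j\<in>{..<n} - {i}. X2 j t)"
    unfolding solves_bvp_def by blast
  have cont: "continuous_on {0..T} (X i)" "continuous_on {0..T} (X1 i)" if "i < n" for i
    using DERIV_continuous_on[OF d1[OF that]] DERIV_continuous_on[OF d2[OF that]] by auto
  have adm: "adm_det (x i) T (X i) (X1 i)" if "i < n" for i
    using bd[OF that] prim_eqI[OF d1[OF that] cont(2)[OF that]] sq_int_continuous[OF cont(2)[OF that]]
    by (simp add: adm_det_iff)
  have "\<exists>c. AE t in N. foc X X1 i t = c" if i: "i < n" for i
  proof -
    have "(foc X X1 i has_derivative (\<lambda>h. 0)) (at t within {0..T})" if t: "t \<in> {0..T}" for t
    proof -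
      have "(foc X X1 i has_real_derivative
        lam * (X2 i t + (\<Sum>j<n. X2 j t)) + \<gamma> * ((\<Sum>j<n. X1 j t - 0) - (X1 i t - 0)) + b t - a i * X i t) (at t within {0..T})"
        unfolding foc_def[abs_def]
        by (intro DERIV_diff DERIV_add DERIV_cmult DERIV_sum DERIV_const prim_has_derivative cont b_cont d1 d2)
          (use i t in auto)
      moreover have "lam * (X2 i t + (\<Sum>j<n. X2 j t)) + \<gamma> * ((\<Sum>j<n. X1 j t - 0) - (X1 i t - 0)) + b t - a i * X i t = 0"
        using ode[OF i t] i by (simp add: sum.remove[of "{..<n}" i] a_def algebra_simps)
      ultimately show ?thesis by (simp add: has_field_derivative_def lambda_zero)
    qed
    from has_derivative_zero_constant[OF _ this]
    obtain c where "\<forall>t\<in>{0..T}. foc X X1 i t = c" by auto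
    then show ?thesis by (intro exI[of _ c] AE_I2) auto
  qed
  then have "nash_mv M W T S0 \<sigma> b \<gamma> lam n x \<alpha> X X1"
    unfolding nash_iff_foc using adm by blast
  then show ?thesis by blast
qed

subsection \<open>Solving the first-order condition\<close>

definition centre :: "(real \<Rightarrow> real) \<Rightarrow> real \<Rightarrow> real" where
  "centre f t = f t - (\<integral>s. f s \<partial>N) / T"

text \<open>The matrix \<open>P\<close> is \<open>lam\<close> times the sum of the identity and the
  all-ones matrix; its eigenvalues are among \<open>lam\<close> and \<open>lam * (n + 1)\<close>.
  Only the coupling is centred, because \<open>P\<close> preserves mean zero.\<close>

definition foc_op :: "(nat \<Rightarrow> real \<Rightarrow> real) \<Rightarrow> nat \<Rightarrow> real \<Rightarrow> real" where
  "foc_op w i t = lam * (w i t + (\<Sum>j<n. w j t)) + centre (coupling w i) t"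

definition relax :: "real \<Rightarrow> (nat \<Rightarrow> real \<Rightarrow> real) \<Rightarrow> nat \<Rightarrow> real \<Rightarrow> real" where
  "relax \<rho> w i t = w i t - \<rho> * foc_op w i t"

definition energy :: "(nat \<Rightarrow> real \<Rightarrow> real) \<Rightarrow> real \<Rightarrow> real" where
  "energy w t = (\<Sum>i<n. (w i t)\<^sup>2)"

definition total_energy :: "(nat \<Rightarrow> real \<Rightarrow> real) \<Rightarrow> real" where
  "total_energy w = (\<Sum>i<n. \<integral>t. (w i t)\<^sup>2 \<partial>N)"

lemma energy_nonneg: "0 \<le> energy w t"
  by (simp add: energy_def sum_nonneg)

lemma total_energy_nonneg: "0 \<le> total_energy w"
  by (simp add: total_energy_def sum_nonneg)

lemma square_le_energy: "i < n \<Longrightarrow> (w i t)\<^sup>2 \<le> energy w t"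
  unfolding energy_def by (rule member_le_sum) auto

lemma sum_square_le_energy: "(\<Sum>i<n. w i t)\<^sup>2 \<le> n * energy w t"
  using Cauchy_Schwarz_ineq_sum[of "\<lambda>_. 1" "\<lambda>i. w i t" "{..<n}"] by (simp add: energy_def)

lemma integrable_energy:
  assumes "\<And>j. j < n \<Longrightarrow> sq_int (w j)"
  shows "integrable N (energy w)" "(\<integral>t. energy w t \<partial>N) = total_energy w"
  unfolding energy_def[abs_def] total_energy_def
  using assms sq_int_square by (auto intro!: Bochner_Integration.integral_sum)

lemma sq_int_centre: "sq_int f \<Longrightarrow> sq_int (centre f)"
  unfolding centre_def[abs_def] by (intro sq_int_diff sq_int_const)

lemma integral_centre: "sq_int f \<Longrightarrow> (\<integral>t. centre f t \<partial>N) = 0"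
  unfolding centre_def using T_pos sq_int_integrable[of f] by simp

lemma sq_int_foc_op:
  assumes "\<And>j. j < n \<Longrightarrow> sq_int (w j)" "i < n"
  shows "sq_int (foc_op w i)"
  unfolding foc_op_def[abs_def]
  by (intro sq_int_add sq_int_cmult sq_int_sum sq_int_centre sq_int_coupling assms) auto

lemma continuous_on_coupling:
  assumes w: "\<And>j. j < n \<Longrightarrow> continuous_on {0..T} (w j)" and i: "i < n"
  shows "continuous_on {0..T} (coupling w i)"
  unfolding coupling_def[abs_def]
  by (intro continuous_intros continuous_on_prim w i) auto

lemma continuous_on_relax:
  assumes w: "\<And>j. j < n \<Longrightarrow> continuous_on {0..T} (w j)" and i: "i < n"
  shows "continuous_on {0..T} (relax \<rho> w i)"
  unfolding relax_def[abs_def] foc_op_def centre_def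
  by (intro continuous_intros continuous_on_coupling w i) auto

text \<open>Centring hides the coupling from the integral. This serves twice: the iteration stays
  among mean-zero rates, and in \<open>bvp_solvable\<close> a solution is seen to have mean zero
  because \<open>P\<close> is injective.\<close>

lemma integral_foc_op:
  assumes w: "\<And>j. j < n \<Longrightarrow> sq_int (w j)" and i: "i < n"
  shows "(\<integral>t. foc_op w i t \<partial>N) = lam * ((\<integral>t. w i t \<partial>N) + (\<Sum>j<n. \<integral>t. w j t \<partial>N))"
proof -
  have "integrable N (centre (coupling w i))" "(\<integral>t. centre (coupling w i) t \<partial>N) = 0"
    using sq_int_coupling[of w, OF w i]
    by (auto intro: sq_int_integrable sq_int_centre integral_centre)
  moreover have "integrable N (\<lambda>t. \<Sum>j<n. w j t)" "(\<integral>t. (\<Sum>j<n. w j t) \<partial>N) = (\<Sum>j<n. \<integral>t. w j t \<partial>N)"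
    using w by (auto intro!: sq_int_integrable sq_int_sum Bochner_Integration.integral_sum)
  ultimately show ?thesis using sq_int_integrable[OF w[OF i]] unfolding foc_op_def by simp
qed

lemma integral_relax:
  assumes w: "\<And>j. j < n \<Longrightarrow> sq_int (w j)" and w0: "\<And>j. j < n \<Longrightarrow> (\<integral>t. w j t \<partial>N) = 0" and i: "i < n"
  shows "(\<integral>t. relax \<rho> w i t \<partial>N) = 0"
  using integral_foc_op[of w, OF w i] sq_int_integrable[OF sq_int_foc_op[of w, OF w i]]
    sq_int_integrable[OF w[OF i]] w0 i
  by (simp add: relax_def)

lemma coupling_add:
  assumes u: "\<And>j. j < n \<Longrightarrow> sq_int (u j)" and v: "\<And>j. j < n \<Longrightarrow> sq_int (v j)" and i: "i < n"
  shows "coupling (\<lambda>j t. u j t + v j t) i t = coupling u i t + coupling v i t"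
proof -
  have su: "integrable N (\<lambda>t. \<Sum>j<n. u j t)" and sv: "integrable N (\<lambda>t. \<Sum>j<n. v j t)"
    using u v by (auto intro!: sq_int_integrable sq_int_sum)
  note ui = sq_int_integrable[OF u[OF i]] and vi = sq_int_integrable[OF v[OF i]]
  have P: "prim (\<lambda>t. u i t + v i t) = (\<lambda>t. prim (u i) t + prim (v i) t)"
    by (rule ext) (rule prim_add[OF ui vi])
  have PP: "prim (\<lambda>t. prim (u i) t + prim (v i) t) t = prim (prim (u i)) t + prim (prim (v i)) t"
    by (rule prim_add) (intro sq_int_integrable sq_int_prim ui vi)+
  have PS: "prim (\<lambda>t. \<Sum>j<n. u j t + v j t) t = prim (\<lambda>t. \<Sum>j<n. u j t) t + prim (\<lambda>t. \<Sum>j<n. v j t) t"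
    unfolding sum.distrib by (rule prim_add[OF su sv])
  show ?thesis unfolding coupling_def PS P PP by (simp add: algebra_simps)
qed

text \<open>Used to split the series in \<open>foc_op_solvable\<close> into a partial sum and a
  tail. The integrals in \<open>centre\<close> and \<open>coupling\<close> are additive only for
  integrable functions, hence the hypotheses.\<close>

lemma relax_add:
  assumes u: "\<And>j. j < n \<Longrightarrow> sq_int (u j)" and v: "\<And>j. j < n \<Longrightarrow> sq_int (v j)" and i: "i < n"
  shows "relax \<rho> (\<lambda>j t. u j t + v j t) i t = relax \<rho> u i t + relax \<rho> v i t"
proof -
  have "coupling (\<lambda>j t. u j t + v j t) i = (\<lambda>t. coupling u i t + coupling v i t)"
    by (rule ext) (rule coupling_add[of u v, OF u v i])
  then have "centre (coupling (\<lambda>j t. u j t + v j t) i) t = centre (coupling u i) t + centre (coupling v i) t"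
    unfolding centre_def
    using sq_int_integrable[OF sq_int_coupling[of u, OF u i]] sq_int_integrable[OF sq_int_coupling[of v, OF v i]]
    by (simp add: add_divide_distrib)
  then show ?thesis
    unfolding relax_def foc_op_def by (simp add: sum.distrib algebra_simps)
qed

lemma relax_zero: "relax \<rho> (\<lambda>_ _. 0) i t = 0"
  by (simp add: relax_def foc_op_def centre_def coupling_def prim_def)

section \<open>Contraction estimates for the damped iteration\<close>

lemma coupling_bound:
  obtains C where "0 \<le> C"
    "\<And>w i t. (\<And>j. j < n \<Longrightarrow> sq_int (w j)) \<Longrightarrow> i < n \<Longrightarrow> t \<in> {0..T} \<Longrightarrow>
       (centre (coupling w i) t)\<^sup>2 \<le> C * total_energy w"
proof
  define A where "A = (\<Sum>i<n. (a i)\<^sup>2)"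
  \<comment> \<open>The factor 3 comes from squaring three terms. Each \<open>prim\<close>
    contributes through \<open>prim_square_le\<close>: \<open>T * n\<close> for the sum of the
    rates, \<open>T\<close> for the own rate, and the cube of \<open>T\<close> for the iterated
    primitive. Centring later costs the factor 4.\<close>
  define c where "c = 3 * (\<gamma>\<^sup>2 * (T * n) + \<gamma>\<^sup>2 * T + A * (T * (T * T)))"
  have A0: "0 \<le> A" by (simp add: A_def sum_nonneg)
  have c0: "0 \<le> c" using A0 T_pos by (simp add: c_def)
  then show "0 \<le> 4 * c" by simp
  fix w :: "nat \<Rightarrow> real \<Rightarrow> real" and i t
  assume w: "\<And>j. j < n \<Longrightarrow> sq_int (w j)" and i: "i < n" and t: "t \<in> {0..T}"
  define K where "K = total_energy w"
  have K0: "0 \<le> K" by (simp add: K_def total_energy_nonneg)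
  define s where "s = (\<lambda>t. \<Sum>j<n. w j t)"
  have sqs: "sq_int s" unfolding s_def by (rule sq_int_sum) (use w in auto)
  have ss: "(\<integral>t. (s t)\<^sup>2 \<partial>N) \<le> n * K"
  proof -
    have "(\<integral>t. (s t)\<^sup>2 \<partial>N) \<le> (\<integral>t. n * energy w t \<partial>N)"
      by (rule integral_mono) (use sq_int_square[OF sqs] integrable_energy(1)[of w, OF w] sum_square_le_energy[of w] in \<open>auto simp: s_def\<close>)
    then show ?thesis using integrable_energy(2)[of w, OF w] by (simp add: K_def)
  qed
  have wi: "(\<integral>t. (w i t)\<^sup>2 \<partial>N) \<le> K"
    unfolding K_def total_energy_def by (rule member_le_sum) (use i in auto)
  have p1: "(prim s u)\<^sup>2 \<le> T * (n * K)" for u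
    by (rule order_trans[OF prim_square_le[OF sqs] mult_left_mono[OF ss]]) (use T_pos in simp)
  have p2: "(prim (w i) u)\<^sup>2 \<le> T * K" for u
    by (rule order_trans[OF prim_square_le[OF w[OF i]] mult_left_mono[OF wi]]) (use T_pos in simp)
  have sqP: "sq_int (prim (w i))" by (rule sq_int_prim[OF sq_int_integrable[OF w[OF i]]])
  have "(\<integral>u. (prim (w i) u)\<^sup>2 \<partial>N) \<le> (\<integral>u. T * K \<partial>N)"
    by (rule integral_mono) (use sq_int_square[OF sqP] p2 in auto)
  then have pp: "(\<integral>u. (prim (w i) u)\<^sup>2 \<partial>N) \<le> T * T * K" by (simp add: mult_ac)
  have p3: "(prim (prim (w i)) u)\<^sup>2 \<le> T * (T * T * K)" for u
    by (rule order_trans[OF prim_square_le[OF sqP] mult_left_mono[OF pp]]) (use T_pos in simp)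
  have ai: "(a i)\<^sup>2 \<le> A" unfolding A_def by (rule member_le_sum) (use i in auto)
  \<comment> \<open>The gap is \<open>(p + q)^2 + (p + r)^2 + (q - r)^2\<close>.\<close>
  have three: "(p - q - r)\<^sup>2 \<le> 3 * (p\<^sup>2 + q\<^sup>2 + r\<^sup>2)" for p q r :: real
    using sum_squares_ge_zero[of "p + q" "p + r"] zero_le_power2[of "q - r"]
    by (simp add: power2_eq_square algebra_simps)
  have kb: "(coupling w i u)\<^sup>2 \<le> c * K" for u
  proof -
    have "(coupling w i u)\<^sup>2 = (\<gamma> * prim s u - \<gamma> * prim (w i) u - a i * prim (prim (w i)) u)\<^sup>2"
      by (simp add: coupling_def s_def algebra_simps)
    also have "\<dots> \<le> 3 * ((\<gamma> * prim s u)\<^sup>2 + (\<gamma> * prim (w i) u)\<^sup>2 + (a i * prim (prim (w i)) u)\<^sup>2)"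
      by (rule three)
    also have "\<dots> \<le> 3 * (\<gamma>\<^sup>2 * (T * (n * K)) + \<gamma>\<^sup>2 * (T * K) + A * (T * (T * T * K)))"
      unfolding power_mult_distrib
      by (intro mult_left_mono[of _ _ 3] add_mono mult_left_mono[OF p1] mult_left_mono[OF p2] mult_mono[OF ai p3] A0) auto
    also have "\<dots> = c * K" by (simp add: c_def algebra_simps)
    finally show ?thesis .
  qed
  have sqk: "sq_int (coupling w i)" by (rule sq_int_coupling[OF w i])
  define m where "m = (\<integral>u. coupling w i u \<partial>N) / T"
  have "(\<integral>u. (coupling w i u)\<^sup>2 \<partial>N) \<le> (\<integral>u. c * K \<partial>N)"
    by (rule integral_mono) (use sq_int_square[OF sqk] kb in auto)
  then have "(\<integral>u. (coupling w i u)\<^sup>2 \<partial>N) \<le> T * (c * K)" by (simp add: mult_ac)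
  then have "(\<integral>u. coupling w i u \<partial>N)\<^sup>2 \<le> T * (T * (c * K))"
    using integral_square_le[OF sqk] T_pos by (meson mult_left_mono less_imp_le order_trans)
  then have m: "m\<^sup>2 \<le> c * K" using T_pos by (simp add: m_def power_divide field_simps power2_eq_square)
  have "(centre (coupling w i) t)\<^sup>2 = (coupling w i t - m)\<^sup>2" by (simp add: centre_def m_def)
  also have "\<dots> \<le> 2 * (coupling w i t)\<^sup>2 + 2 * m\<^sup>2"
    using zero_le_power2[of "coupling w i t + m"] by (simp add: power2_eq_square algebra_simps)
  also have "\<dots> \<le> 4 * c * K" using kb[of t] m by simp
  finally show "(centre (coupling w i) t)\<^sup>2 \<le> 4 * c * total_energy w" by (simp add: K_def)
qed

text \<open>With \<open>m = \<rho> * lam\<close>, the matrix part of \<open>relax\<close> has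
  eigenvalues among \<open>1 - m\<close> and \<open>1 - m * (n + 1)\<close>; the condition
  \<open>m * (n + 2) \<le> 2\<close> says that the latter is at most \<open>1 - m\<close> in
  absolute value. The coupling is split off by Young's inequality with weight \<open>m\<close>, and
  \<open>(1 + m) * (1 - m)^2 \<le> 1 - m^2\<close>.\<close>

lemma energy_relax_le:
  fixes C :: real
  assumes C: "\<And>i. i < n \<Longrightarrow> (centre (coupling w i) t)\<^sup>2 \<le> C * total_energy w"
    and \<rho>: "0 < \<rho>" and \<mu>: "\<rho> * lam * (n + 2) \<le> 2"
  shows "energy (relax \<rho> w) t \<le> (1 - (\<rho> * lam)\<^sup>2) * energy w t
    + (1 + 1 / (\<rho> * lam)) * \<rho>\<^sup>2 * (n * C) * total_energy w"
proof -
  define m where "m = \<rho> * lam"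
  define s where "s = (\<Sum>j<n. w j t)"
  define k where "k i = centre (coupling w i) t" for i
  define E where "E = energy w t"
  have m0: "0 < m" using \<rho> lam_pos by (simp add: m_def)
  have m1: "m * (n + 2) \<le> 2" using \<mu> by (simp add: m_def)
  have "m * 2 \<le> m * (n + 2)" using m0 by (intro mult_left_mono) auto
  then have m2: "m \<le> 1" using m1 by simp
  have E0: "0 \<le> E" by (simp add: E_def energy_nonneg)
  have rel: "relax \<rho> w i t = ((1 - m) * w i t - m * s) + (- \<rho> * k i)" for i
    by (simp add: relax_def foc_op_def s_def k_def m_def algebra_simps)
  have "(\<Sum>i<n. ((1 - m) * w i t - m * s)\<^sup>2)
     = (\<Sum>i<n. (1 - m)\<^sup>2 * (w i t)\<^sup>2 - 2 * (1 - m) * m * s * w i t + m\<^sup>2 * s\<^sup>2)"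
    by (intro sum.cong) (auto simp: power2_diff power_mult_distrib)
  also have "\<dots> = (1 - m)\<^sup>2 * E - 2 * (1 - m) * m * s * s + n * (m\<^sup>2 * s\<^sup>2)"
    by (simp add: sum.distrib sum_subtractf sum_distrib_left[symmetric] E_def energy_def) (simp add: s_def)
  also have "\<dots> = (1 - m)\<^sup>2 * E - m * s\<^sup>2 * (2 - m * (n + 2))"
    by (simp add: power2_eq_square algebra_simps)
  also have "\<dots> \<le> (1 - m)\<^sup>2 * E"
    using m0 m1 by simp
  finally have pp: "(\<Sum>i<n. ((1 - m) * w i t - m * s)\<^sup>2) \<le> (1 - m)\<^sup>2 * E" .
  have "(\<Sum>i<n. (k i)\<^sup>2) \<le> (\<Sum>i<n. C * total_energy w)"
    using C by (intro sum_mono) (auto simp: k_def)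
  then have kk: "(\<Sum>i<n. (k i)\<^sup>2) \<le> n * C * total_energy w" by simp
  have "energy (relax \<rho> w) t \<le> (\<Sum>i<n. (1 + m) * ((1 - m) * w i t - m * s)\<^sup>2 + (1 + 1 / m) * (- \<rho> * k i)\<^sup>2)"
    unfolding energy_def rel by (intro sum_mono weighted_square_sum m0)
  also have "\<dots> = (1 + m) * (\<Sum>i<n. ((1 - m) * w i t - m * s)\<^sup>2) + (1 + 1 / m) * \<rho>\<^sup>2 * (\<Sum>i<n. (k i)\<^sup>2)"
    by (simp add: sum.distrib sum_distrib_left power_mult_distrib mult.assoc)
  also have "\<dots> \<le> (1 + m) * ((1 - m)\<^sup>2 * E) + (1 + 1 / m) * \<rho>\<^sup>2 * (n * C * total_energy w)"
    using m0 by (intro add_mono mult_left_mono pp kk) auto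
  also have "(1 + m) * ((1 - m)\<^sup>2 * E) \<le> (1 - m\<^sup>2) * E"
  proof -
    have "0 \<le> m * ((1 + m) * (1 - m)) * E" using m0 m2 E0 by simp
    then show ?thesis by (simp add: power2_eq_square algebra_simps)
  qed
  finally show ?thesis by (simp add: m_def E_def mult.assoc)
qed

text \<open>Expand the square. The cross term is at least \<open>lam\<close> times the energy: the
  matrix gives that much, the coupling is accretive, and the mean removed by \<open>centre\<close>
  is invisible to mean-zero rates. The term of order \<open>\<rho>^2\<close> is estimated crudely,
  with \<open>4 * lam^2 * (1 + n)\<close> from the matrix, \<open>2 * C * T\<close> from the
  coupling, and a factor \<open>n\<close> for the sum over agents.\<close>

lemma total_energy_relax_le:
  assumes C: "\<And>i t. i < n \<Longrightarrow> t \<in> {0..T} \<Longrightarrow> (centre (coupling w i) t)\<^sup>2 \<le> C * total_energy w"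
    and w: "\<And>j. j < n \<Longrightarrow> sq_int (w j)" and w0: "\<And>j. j < n \<Longrightarrow> (\<integral>t. w j t \<partial>N) = 0"
    and \<rho>: "0 < \<rho>"
  shows "total_energy (relax \<rho> w) \<le>
    (1 - 2 * \<rho> * lam + \<rho>\<^sup>2 * (n * (4 * lam\<^sup>2 * (1 + n) + 2 * C * T))) * total_energy w"
proof -
  define K where "K = total_energy w"
  define s where "s = (\<lambda>t. \<Sum>j<n. w j t)"
  have sqs: "sq_int s" unfolding s_def by (rule sq_int_sum) (use w in auto)
  have sqF: "sq_int (foc_op w i)" if "i < n" for i by (rule sq_int_foc_op[OF w that])
  have exp: "(\<integral>t. (relax \<rho> w i t)\<^sup>2 \<partial>N) = (\<integral>t. (w i t)\<^sup>2 \<partial>N) - 2 * \<rho> * (\<integral>t. w i t * foc_op w i t \<partial>N)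
      + \<rho>\<^sup>2 * (\<integral>t. (foc_op w i t)\<^sup>2 \<partial>N)" if i: "i < n" for i
  proof -
    have "(\<integral>t. (relax \<rho> w i t)\<^sup>2 \<partial>N) = (\<integral>t. (w i t)\<^sup>2 - 2 * \<rho> * (w i t * foc_op w i t) + \<rho>\<^sup>2 * (foc_op w i t)\<^sup>2 \<partial>N)"
      by (intro Bochner_Integration.integral_cong) (auto simp: relax_def power2_eq_square algebra_simps)
    then show ?thesis
      using sq_int_square[OF w[OF i]] sq_int_square[OF sqF[OF i]] sq_int_mult[OF w[OF i] sqF[OF i]] by simp
  qed
  have wF: "(\<integral>t. w i t * foc_op w i t \<partial>N) = lam * (\<integral>t. (w i t)\<^sup>2 \<partial>N) + lam * (\<integral>t. w i t * s t \<partial>N)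
      + (\<integral>t. w i t * coupling w i t \<partial>N)" if i: "i < n" for i
  proof -
    define m where "m = (\<integral>t. coupling w i t \<partial>N) / T"
    have "(\<integral>t. w i t * foc_op w i t \<partial>N)
      = (\<integral>t. lam * (w i t)\<^sup>2 + lam * (w i t * s t) + w i t * coupling w i t - m * w i t \<partial>N)"
      by (intro Bochner_Integration.integral_cong)
        (auto simp: foc_op_def centre_def m_def s_def power2_eq_square algebra_simps)
    then show ?thesis
      using sq_int_square[OF w[OF i]] sq_int_mult[OF w[OF i] sqs] sq_int_integrable[OF w[OF i]] w0[OF i]
        sq_int_mult[OF w[OF i] sq_int_coupling[of w, OF w i]] by simp
  qed
  have "lam * K \<le> (\<Sum>i<n. \<integral>t. w i t * foc_op w i t \<partial>N)"
  proof -
    have "(\<Sum>i<n. \<integral>t. w i t * foc_op w i t \<partial>N) = lam * K + lam * (\<Sum>i<n. \<integral>t. w i t * s t \<partial>N)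
      + (\<Sum>i<n. \<integral>t. w i t * coupling w i t \<partial>N)"
      by (simp add: wF sum.distrib sum_distrib_left K_def total_energy_def)
    moreover have "(\<Sum>i<n. \<integral>t. w i t * s t \<partial>N) = (\<integral>t. (s t)\<^sup>2 \<partial>N)"
      using Bochner_Integration.integral_sum[of "{..<n}" N "\<lambda>i t. w i t * s t"] sq_int_mult[OF w sqs]
      by (simp add: sum_distrib_right[symmetric] s_def[THEN fun_cong, symmetric] power2_eq_square)
    moreover have "0 \<le> lam * (\<integral>t. (s t)\<^sup>2 \<partial>N)" using lam_pos by simp
    ultimately show ?thesis using coupling_accretive[of w, OF w w0] by simp
  qed
  then have part1: "2 * \<rho> * (lam * K) \<le> 2 * \<rho> * (\<Sum>i<n. \<integral>t. w i t * foc_op w i t \<partial>N)"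
    using \<rho> by (intro mult_left_mono) auto
  have FF: "(\<integral>t. (foc_op w i t)\<^sup>2 \<partial>N) \<le> (4 * lam\<^sup>2 * (1 + n) + 2 * C * T) * K" if i: "i < n" for i
  proof -
    have "(\<integral>t. (foc_op w i t)\<^sup>2 \<partial>N) \<le> (\<integral>t. 4 * lam\<^sup>2 * (1 + n) * energy w t + 2 * (C * K) \<partial>N)"
    proof (rule integral_mono)
      fix t assume "t \<in> space N"
      then have t: "t \<in> {0..T}" by simp
      have two: "(p + q)\<^sup>2 \<le> 2 * p\<^sup>2 + 2 * q\<^sup>2" for p q :: real
        using zero_le_power2[of "p - q"] by (simp add: power2_eq_square algebra_simps)
      have "(foc_op w i t)\<^sup>2 \<le> 2 * (lam * (w i t + s t))\<^sup>2 + 2 * (centre (coupling w i) t)\<^sup>2"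
        unfolding foc_op_def s_def by (rule two)
      also have "\<dots> \<le> 2 * (lam\<^sup>2 * (2 * energy w t + 2 * (n * energy w t))) + 2 * (C * K)"
        unfolding power_mult_distrib K_def
        using two[of "w i t" "s t"] square_le_energy[OF i, of w t] sum_square_le_energy[of w t] C[OF i t]
        by (intro add_mono mult_left_mono[of _ _ 2] mult_left_mono) (auto simp: s_def)
      also have "\<dots> = 4 * lam\<^sup>2 * (1 + n) * energy w t + 2 * (C * K)" by (simp add: algebra_simps)
      finally show "(foc_op w i t)\<^sup>2 \<le> 4 * lam\<^sup>2 * (1 + n) * energy w t + 2 * (C * K)" .
    qed (use sq_int_square[OF sqF[OF i]] integrable_energy(1)[of w, OF w] in auto)
    also have "\<dots> = (4 * lam\<^sup>2 * (1 + n) + 2 * C * T) * K"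
      using integrable_energy[of w, OF w] by (simp add: K_def algebra_simps)
    finally show ?thesis .
  qed
  have "(\<Sum>i<n. \<integral>t. (foc_op w i t)\<^sup>2 \<partial>N) \<le> (\<Sum>i<n. (4 * lam\<^sup>2 * (1 + n) + 2 * C * T) * K)"
    by (rule sum_mono) (use FF in auto)
  then have part2: "\<rho>\<^sup>2 * (\<Sum>i<n. \<integral>t. (foc_op w i t)\<^sup>2 \<partial>N) \<le> \<rho>\<^sup>2 * (n * ((4 * lam\<^sup>2 * (1 + n) + 2 * C * T) * K))"
    by (intro mult_left_mono) auto
  have "total_energy (relax \<rho> w) = K - 2 * \<rho> * (\<Sum>i<n. \<integral>t. w i t * foc_op w i t \<partial>N)
    + \<rho>\<^sup>2 * (\<Sum>i<n. \<integral>t. (foc_op w i t)\<^sup>2 \<partial>N)"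
    by (simp add: total_energy_def exp sum.distrib sum_subtractf sum_distrib_left K_def)
  also have "\<dots> \<le> K - 2 * \<rho> * (lam * K) + \<rho>\<^sup>2 * (n * ((4 * lam\<^sup>2 * (1 + n) + 2 * C * T) * K))"
    using part1 part2 by linarith
  finally show ?thesis by (simp add: K_def algebra_simps)
qed

text \<open>The \<open>L\<^sup>2\<close> norm contracts by accretivity, but it is not complete on continuous functions. Since the
  coupling maps \<open>L\<^sup>2\<close> into bounded functions, adding a multiple of it to the pointwise energy gives a
  quantity that contracts at each time and controls uniform convergence.\<close>

lemma relax_contraction:
  obtains \<rho> \<theta> D L where "0 < \<rho>" "0 < \<theta>" "\<theta> < 1" "0 \<le> D" "0 \<le> L"
    "\<And>w t. (\<And>j. j < n \<Longrightarrow> sq_int (w j)) \<Longrightarrow> (\<And>j. j < n \<Longrightarrow> (\<integral>t. w j t \<partial>N) = 0) \<Longrightarrow> t \<in> {0..T} \<Longrightarrow>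
       energy (relax \<rho> w) t + D * total_energy (relax \<rho> w) \<le> \<theta> * (energy w t + D * total_energy w)"
    "\<And>w t. (\<And>j. j < n \<Longrightarrow> sq_int (w j)) \<Longrightarrow> t \<in> {0..T} \<Longrightarrow>
       energy (relax \<rho> w) t \<le> energy w t + L * total_energy w"
proof -
  obtain C where C0: "0 \<le> C" and C: "\<And>w i t. (\<And>j. j < n \<Longrightarrow> sq_int (w j)) \<Longrightarrow> i < n \<Longrightarrow> t \<in> {0..T} \<Longrightarrow>
       (centre (coupling w i) t)\<^sup>2 \<le> C * total_energy w"
    by (rule coupling_bound) blast
  define C2 where "C2 = n * (4 * lam\<^sup>2 * (1 + n) + 2 * C * T)"
  \<comment> \<open>Small enough for two demands: \<open>m * (n + 2) \<le> 1\<close> for the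
    pointwise estimate, and \<open>\<rho> * C2 \<le> lam\<close>, so that the term of order
    \<open>\<rho>^2\<close> uses up at most half of the gain \<open>2 * m\<close>.\<close>
  define \<rho> where "\<rho> = lam / (C2 + lam\<^sup>2 * (n + 2))"
  define m where "m = \<rho> * lam"
  define L where "L = (1 + 1 / m) * \<rho>\<^sup>2 * (n * C)"
  \<comment> \<open>Chosen so that \<open>D * m = 2 * L\<close>: per step the weighted square norm
    loses at least \<open>2 * L\<close> times the total energy, of which \<open>L\<close> pays for
    the coupling in the pointwise bound, and the rest gives the factor \<theta>.\<close>
  define D where "D = 2 * L / m"
  define \<theta> where "\<theta> = 1 - m\<^sup>2 / 2"
  have C20: "0 \<le> C2" using C0 T_pos by (simp add: C2_def)
  have pos: "0 < C2 + lam\<^sup>2 * (n + 2)" using C20 lam_pos by (intro add_nonneg_pos) auto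
  have \<rho>0: "0 < \<rho>" using pos lam_pos by (simp add: \<rho>_def)
  have m0: "0 < m" using \<rho>0 lam_pos by (simp add: m_def)
  have m1: "m * (n + 2) \<le> 1"
    using pos C20 by (simp add: m_def \<rho>_def power2_eq_square field_simps)
  have "m * 2 \<le> m * (n + 2)" using m0 by (intro mult_left_mono) auto
  then have m2: "m \<le> 1 / 2" using m1 by simp
  have \<rho>C2: "\<rho> * C2 \<le> lam"
  proof -
    have "\<rho> * C2 \<le> \<rho> * (C2 + lam\<^sup>2 * (n + 2))" using \<rho>0 by (intro mult_left_mono) auto
    also have "\<dots> = lam" using pos by (simp add: \<rho>_def)
    finally show ?thesis .
  qed
  have L0: "0 \<le> L" using m0 C0 by (simp add: L_def)
  have mm: "m\<^sup>2 \<le> m" using m0 m2 by (simp add: power2_eq_square)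
  show ?thesis
  proof (rule that[of \<rho> \<theta> D L])
    show "0 < \<rho>" "0 \<le> L" by fact+
    show "0 < \<theta>" "\<theta> < 1" using m0 m2 mm by (auto simp: \<theta>_def)
    show "0 \<le> D" using L0 m0 by (simp add: D_def)
    have E: "energy (relax \<rho> w) t \<le> (1 - m\<^sup>2) * energy w t + L * total_energy w"
      if w: "\<And>j. j < n \<Longrightarrow> sq_int (w j)" and t: "t \<in> {0..T}" for w t
      using energy_relax_le[of w t C \<rho>, OF C[of w, OF w _ t] \<rho>0] m1
      by (simp add: L_def m_def)
    show "energy (relax \<rho> w) t \<le> energy w t + L * total_energy w"
      if w: "\<And>j. j < n \<Longrightarrow> sq_int (w j)" and t: "t \<in> {0..T}" for w t
    proof -
      have "(1 - m\<^sup>2) * energy w t \<le> 1 * energy w t"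
        by (rule mult_right_mono) (auto simp: energy_nonneg)
      then show ?thesis using E[of w, OF w t] by simp
    qed
    show "energy (relax \<rho> w) t + D * total_energy (relax \<rho> w) \<le> \<theta> * (energy w t + D * total_energy w)"
      if w: "\<And>j. j < n \<Longrightarrow> sq_int (w j)" and w0: "\<And>j. j < n \<Longrightarrow> (\<integral>t. w j t \<partial>N) = 0" and t: "t \<in> {0..T}" for w t
    proof -
      have "1 - 2 * \<rho> * lam + \<rho>\<^sup>2 * C2 \<le> 1 - m"
        using mult_left_mono[OF \<rho>C2, of \<rho>] \<rho>0 by (simp add: m_def power2_eq_square mult.assoc)
      then have "total_energy (relax \<rho> w) \<le> (1 - m) * total_energy w"
        using total_energy_relax_le[of w C \<rho>, OF C[of w, OF w] w w0 \<rho>0] total_energy_nonneg[of w]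
        unfolding C2_def by (meson mult_right_mono order_trans)
      then have "D * total_energy (relax \<rho> w) \<le> D * ((1 - m) * total_energy w)"
        using \<open>0 \<le> D\<close> by (rule mult_left_mono)
      then have "energy (relax \<rho> w) t + D * total_energy (relax \<rho> w)
        \<le> (1 - m\<^sup>2) * energy w t + (L + D * (1 - m)) * total_energy w"
        using E[of w, OF w t] by (simp add: algebra_simps)
      also have "\<dots> \<le> \<theta> * energy w t + (\<theta> * D) * total_energy w"
      proof (intro add_mono mult_right_mono energy_nonneg total_energy_nonneg)
        show "1 - m\<^sup>2 \<le> \<theta>" by (simp add: \<theta>_def)
        have "D * m = 2 * L" using m0 by (simp add: D_def)
        moreover have "D * m\<^sup>2 \<le> D * m" using mm \<open>0 \<le> D\<close> by (rule mult_left_mono)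
        ultimately show "L + D * (1 - m) \<le> \<theta> * D"
          by (simp add: \<theta>_def algebra_simps)
      qed
      finally show ?thesis by (simp add: algebra_simps)
    qed
  qed
qed

section \<open>Solution by a Neumann series\<close>

text \<open>Since \<open>w - relax \<rho> w = \<rho> * foc_op w\<close>, the equation reads
  \<open>w = relax \<rho> w + g\<close>. Its solution is the sum of the iterates \<open>d k\<close>
  of \<open>g\<close> under the linear map \<open>relax \<rho>\<close>. The iterates have mean zero,
  as the contraction requires, and decay uniformly like powers of \<open>sqrt \<theta>\<close>,
  because the energy is quadratic.\<close>

lemma foc_op_solvable:
  assumes f: "\<And>i. i < n \<Longrightarrow> continuous_on {0..T} (f i)"
  obtains w where "\<And>i. i < n \<Longrightarrow> continuous_on {0..T} (w i)"
    "\<And>i t. i < n \<Longrightarrow> t \<in> {0..T} \<Longrightarrow> foc_op w i t = centre (f i) t"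
proof -
  obtain \<rho> \<theta> D L where \<rho>: "0 < \<rho>" and \<theta>: "0 < \<theta>" "\<theta> < 1" and D: "0 \<le> D" and L: "0 \<le> L"
    and contr: "\<And>w t. (\<And>j. j < n \<Longrightarrow> sq_int (w j)) \<Longrightarrow> (\<And>j. j < n \<Longrightarrow> (\<integral>t. w j t \<partial>N) = 0) \<Longrightarrow> t \<in> {0..T} \<Longrightarrow>
       energy (relax \<rho> w) t + D * total_energy (relax \<rho> w) \<le> \<theta> * (energy w t + D * total_energy w)"
    and bnd: "\<And>w t. (\<And>j. j < n \<Longrightarrow> sq_int (w j)) \<Longrightarrow> t \<in> {0..T} \<Longrightarrow>
       energy (relax \<rho> w) t \<le> energy w t + L * total_energy w"
    by (rule relax_contraction) blast
  define g where "g i t = \<rho> * centre (f i) t" for i t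
  define d where "d k = (relax \<rho> ^^ k) g" for k
  have dSuc: "d (Suc k) = relax \<rho> (d k)" and d_0: "d 0 = g" for k by (auto simp: d_def)
  have gc: "continuous_on {0..T} (g i)" if "i < n" for i
    unfolding g_def[abs_def] centre_def by (intro continuous_intros f that)
  have dc: "(\<forall>i<n. continuous_on {0..T} (d k i)) \<and> (\<forall>i<n. (\<integral>t. d k i t \<partial>N) = 0)" for k
  proof (induction k)
    case 0
    have "(\<integral>t. g i t \<partial>N) = 0" if "i < n" for i
      using integral_centre[OF sq_int_continuous[OF f[OF that]]] by (simp add: g_def)
    then show ?case using gc by (simp add: d_0)
  next
    case (Suc k)
    then show ?case unfolding dSuc
      by (auto intro!: continuous_on_relax integral_relax sq_int_continuous)
  qed
  have sqd: "sq_int (d k i)" if "i < n" for k i using dc that by (auto intro: sq_int_continuous)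
  have "continuous_on {0..T} (energy g)"
    unfolding energy_def[abs_def] by (intro continuous_intros gc) auto
  from compact_imp_bounded[OF compact_continuous_image[OF this compact_Icc]]
  obtain B0 where B0': "\<And>t. t \<in> {0..T} \<Longrightarrow> \<bar>energy g t\<bar> \<le> B0"
    unfolding bounded_iff by fastforce
  have B0: "energy g t \<le> B0" if "t \<in> {0..T}" for t using B0'[OF that] by simp
  define B where "B = B0 + D * total_energy g"
  have decay: "energy (d k) t + D * total_energy (d k) \<le> \<theta> ^ k * B" if t: "t \<in> {0..T}" for k t
  proof (induction k)
    case 0
    then show ?case using B0[OF t] by (simp add: d_0 B_def)
  next
    case (Suc k)
    have "energy (d (Suc k)) t + D * total_energy (d (Suc k)) \<le> \<theta> * (energy (d k) t + D * total_energy (d k))"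
      unfolding dSuc by (rule contr) (use sqd dc t in auto)
    also have "\<dots> \<le> \<theta> * (\<theta> ^ k * B)" using \<theta> by (intro mult_left_mono Suc) auto
    finally show ?case by (simp add: mult.assoc)
  qed
  have dbound: "norm (d k i t) \<le> sqrt B * sqrt \<theta> ^ k" if i: "i < n" and t: "t \<in> {0..T}" for k i t
  proof -
    have "(d k i t)\<^sup>2 \<le> \<theta> ^ k * B"
      using decay[OF t, of k] square_le_energy[OF i, of "d k" t] mult_nonneg_nonneg[OF D total_energy_nonneg[of "d k"]]
      by linarith
    then have "\<bar>d k i t\<bar> \<le> sqrt (\<theta> ^ k * B)" using real_le_rsqrt real_sqrt_le_mono by fastforce
    then show ?thesis by (simp add: real_sqrt_mult real_sqrt_power mult.commute)
  qed
  have sm: "summable (\<lambda>k. sqrt B * sqrt \<theta> ^ k)"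
    using \<theta> by (intro summable_mult summable_geometric) auto
  define w where "w i t = (\<Sum>k. d k i t)" for i t
  have ul: "uniform_limit {0..T} (\<lambda>K t. \<Sum>k<K. d k i t) (w i) sequentially" if "i < n" for i
    unfolding w_def by (rule Weierstrass_m_test[OF dbound[OF that] sm])
  have wc: "continuous_on {0..T} (w i)" if i: "i < n" for i
  proof (rule uniform_limit_theorem[OF _ ul[OF i]])
    show "\<forall>\<^sub>F K in sequentially. continuous_on {0..T} (\<lambda>t. \<Sum>k<K. d k i t)"
      using dc i by (auto intro!: always_eventually continuous_intros)
  qed simp
  define wK where "wK K i t = (\<Sum>k<K. d k i t)" for K i t
  define h where "h K i t = w i t - wK K i t" for K i t
  have sqwK: "sq_int (wK K i)" if "i < n" for K i
    unfolding wK_def[abs_def] using sqd[OF that] by (intro sq_int_sum)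
  have sqh: "sq_int (h K i)" if "i < n" for K i
    unfolding h_def[abs_def] using sqwK[OF that] sq_int_continuous[OF wc[OF that]] by (intro sq_int_diff)
  have rwK: "relax \<rho> (wK K) i t = wK (Suc K) i t - g i t" if i: "i < n" for K i t
  proof (induction K)
    case 0
    then show ?case using relax_zero[of \<rho> i t] by (simp add: wK_def[abs_def] d_0)
  next
    case (Suc K)
    have "wK (Suc K) = (\<lambda>i t. wK K i t + d K i t)" by (simp add: wK_def fun_eq_iff)
    then have "relax \<rho> (wK (Suc K)) i t = relax \<rho> (wK K) i t + d (Suc K) i t"
      using relax_add[of "wK K" "d K" i \<rho> t, OF sqwK sqd i] by (simp add: dSuc)
    moreover have "wK (Suc (Suc K)) i t = wK (Suc K) i t + d (Suc K) i t" by (simp add: wK_def)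
    ultimately show ?case using Suc by linarith
  qed
  \<comment> \<open>The left side does not involve \<open>K\<close>, while the right side consists
    of tails of the series, which become uniformly small.\<close>
  have res: "w i t - relax \<rho> w i t - g i t = h (Suc K) i t - relax \<rho> (h K) i t" if i: "i < n" for i t K
  proof -
    have "w = (\<lambda>i t. wK K i t + h K i t)" by (simp add: h_def fun_eq_iff)
    then have "relax \<rho> w i t = relax \<rho> (wK K) i t + relax \<rho> (h K) i t"
      using relax_add[of "wK K" "h K" i \<rho> t, OF sqwK sqh i] by simp
    then show ?thesis using rwK[OF i] by (simp add: h_def)
  qed
  have fix_eq: "w i t - relax \<rho> w i t - g i t = 0" if i: "i < n" and t: "t \<in> {0..T}" for i t
  proof (rule ccontr)
    define r where "r = w i t - relax \<rho> w i t - g i t"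
    \<comment> \<open>The tail estimates below give \<open>r^2 \<le> Q * e^2\<close>. With
      \<open>e = |r| / (Q + 1)\<close> this contradicts \<open>Q < (Q + 1)^2\<close>.\<close>
    define Q where "Q = 2 + 2 * (real n + L * (real n * T))"
    have Q: "0 < Q" using L T_pos unfolding Q_def by (intro add_pos_nonneg) auto
    assume "w i t - relax \<rho> w i t - g i t \<noteq> 0"
    then have r: "r \<noteq> 0" by (simp add: r_def)
    define e where "e = \<bar>r\<bar> / (Q + 1)"
    have e: "0 < e" using r Q by (simp add: e_def)
    have "\<forall>\<^sub>F K in sequentially. \<forall>j\<in>{..<n}. \<forall>u\<in>{0..T}. dist (\<Sum>k<K. d k j u) (w j u) < e"
      by (rule eventually_ball_finite) (use uniform_limitD[OF ul e] in auto)
    then obtain K where "\<forall>K'\<ge>K. \<forall>j\<in>{..<n}. \<forall>u\<in>{0..T}. dist (\<Sum>k<K'. d k j u) (w j u) < e"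
      unfolding eventually_sequentially by blast
    then have K: "\<bar>h K' j u\<bar> < e" if "K' \<ge> K" "j < n" "u \<in> {0..T}" for K' j u
      using that by (simp add: dist_real_def h_def wK_def abs_minus_commute)
    have h2: "(h K' j u)\<^sup>2 \<le> e\<^sup>2" if "K' \<ge> K" "j < n" "u \<in> {0..T}" for K' j u
      using K[OF that] e by (intro abs_le_square_iff[THEN iffD1]) auto
    have E: "energy (h K) t \<le> n * e\<^sup>2"
      using sum_mono[of "{..<n}" "\<lambda>j. (h K j t)\<^sup>2" "\<lambda>_. e\<^sup>2"] h2[OF order_refl _ t] by (simp add: energy_def)
    have "(\<integral>u. (h K j u)\<^sup>2 \<partial>N) \<le> T * e\<^sup>2" if j: "j < n" for j
    proof -
      have "(\<integral>u. (h K j u)\<^sup>2 \<partial>N) \<le> (\<integral>u. e\<^sup>2 \<partial>N)"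
        by (rule integral_mono) (use sq_int_square[OF sqh[OF j]] h2[OF order_refl j] in auto)
      then show ?thesis by (simp add: mult.commute)
    qed
    then have TE: "total_energy (h K) \<le> n * (T * e\<^sup>2)"
      using sum_mono[of "{..<n}" "\<lambda>j. \<integral>u. (h K j u)\<^sup>2 \<partial>N" "\<lambda>_. T * e\<^sup>2"] by (simp add: total_energy_def)
    \<comment> \<open>The second bound of \<open>relax_contraction\<close> is the one that applies
      to tails: it asks only for square-integrability, not for mean zero.\<close>
    have "(relax \<rho> (h K) i t)\<^sup>2 \<le> energy (h K) t + L * total_energy (h K)"
      using square_le_energy[OF i, of "relax \<rho> (h K)" t] bnd[of "h K", OF sqh t] by simp
    also have "\<dots> \<le> n * e\<^sup>2 + L * (n * (T * e\<^sup>2))"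
      by (intro add_mono E mult_left_mono TE L)
    finally have R: "(relax \<rho> (h K) i t)\<^sup>2 \<le> n * e\<^sup>2 + L * (n * (T * e\<^sup>2))" .
    have "r\<^sup>2 = (h (Suc K) i t - relax \<rho> (h K) i t)\<^sup>2"
      unfolding r_def res[OF i, of t K] ..
    also have "\<dots> \<le> 2 * (h (Suc K) i t)\<^sup>2 + 2 * (relax \<rho> (h K) i t)\<^sup>2"
      using zero_le_power2[of "h (Suc K) i t + relax \<rho> (h K) i t"] by (simp add: power2_eq_square algebra_simps)
    also have "\<dots> \<le> 2 * e\<^sup>2 + 2 * (n * e\<^sup>2 + L * (n * (T * e\<^sup>2)))"
      using h2[of "Suc K" i t] i t R by (intro add_mono mult_left_mono) auto
    also have "\<dots> = Q * e\<^sup>2" by (simp add: Q_def algebra_simps)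
    also have "\<dots> < (Q + 1) * (Q + 1) * e\<^sup>2"
    proof (rule mult_strict_right_mono)
      show "Q < (Q + 1) * (Q + 1)" using Q by (simp add: algebra_simps add_pos_pos)
    qed (use e in simp)
    also have "\<dots> = r\<^sup>2" using Q by (simp add: e_def power2_eq_square)
    finally show False by simp
  qed
  show thesis
  proof (rule that[of w])
    show "foc_op w i t = centre (f i) t" if "i < n" "t \<in> {0..T}" for i t
      using fix_eq[OF that] \<rho> by (simp add: relax_def g_def)
  qed (rule wc)
qed

section \<open>Regularity and the boundary value problem\<close>

text \<open>Each rate is the constant liquidation rate \<open>- x i / T\<close> plus a mean-zero
  correction \<open>w i\<close>. The coupling of continuous rates is differentiable, so solving the
  equation for \<open>w\<close> by inverting \<open>P\<close> exhibits \<open>w\<close> as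
  differentiable, and differentiating yields the second-order system.\<close>

lemma bvp_solvable: "\<exists>X. solves_bvp T \<sigma> b \<gamma> lam n x \<alpha> X"
proof -
  \<comment> \<open>Minus the part of \<open>foc\<close> that does not depend on \<open>w\<close>
    when the positions are \<open>x i * (1 - t / T) + prim (w i) t\<close>. Constants are left out,
    since \<open>centre\<close> removes them.\<close>
  define f where "f i t = - prim b t + \<gamma> * (t / T) * ((\<Sum>j<n. x j) - x i) + a i * x i * (t - t\<^sup>2 / (2 * T))" for i t
  have f': "(f i has_real_derivative - b t + \<gamma> / T * ((\<Sum>j<n. x j) - x i) + a i * x i * (1 - t / T)) (at t within {0..T})"
    if "t \<in> {0..T}" for i t
    unfolding f_def[abs_def] using T_pos
    by (auto intro!: derivative_eq_intros prim_has_derivative b_cont that simp: field_simps)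
  have fc: "continuous_on {0..T} (f i)" for i by (rule DERIV_continuous_on[OF f'])
  obtain w where wc: "\<And>i. i < n \<Longrightarrow> continuous_on {0..T} (w i)"
    and w: "\<And>i t. i < n \<Longrightarrow> t \<in> {0..T} \<Longrightarrow> foc_op w i t = centre (f i) t"
    by (rule foc_op_solvable[of f, OF fc]) blast
  have sqw: "sq_int (w i)" if "i < n" for i by (rule sq_int_continuous[OF wc[OF that]])
  define s where "s t = (\<Sum>j<n. w j t)" for t
  have sc: "continuous_on {0..T} s" unfolding s_def[abs_def] by (intro continuous_intros wc) auto
  \<comment> \<open>Integrating the equation shows that every mean equals \<open>- J\<close>, with
    \<open>J\<close> the sum of all the means; summing gives \<open>(1 + n) * J = 0\<close>.\<close>
  have w0: "(\<integral>t. w i t \<partial>N) = 0" if i: "i < n" for i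
  proof -
    define J where "J = (\<Sum>j<n. \<integral>t. w j t \<partial>N)"
    have eq: "(\<integral>t. w j t \<partial>N) = - J" if j: "j < n" for j
    proof -
      have "(\<integral>t. foc_op w j t \<partial>N) = (\<integral>t. centre (f j) t \<partial>N)"
        by (rule Bochner_Integration.integral_cong) (use w j in auto)
      then have "lam * ((\<integral>t. w j t \<partial>N) + J) = 0"
        using integral_foc_op[of w, OF sqw j] integral_centre[OF sq_int_continuous[OF fc]] by (simp add: J_def)
      then show ?thesis using lam_pos by simp
    qed
    have "(\<Sum>j<n. \<integral>t. w j t \<partial>N) = (\<Sum>j<n. - J)" by (intro sum.cong) (auto simp: eq)
    then have "J = (\<Sum>j<n. - J)" unfolding J_def[symmetric] .
    then have "(1 + real n) * J = 0" by (simp add: algebra_simps)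
    moreover have "1 + real n \<noteq> 0" by linarith
    ultimately have "J = 0" by simp
    then show ?thesis using eq[OF i] by simp
  qed
  define X where "X i t = x i * (1 - t / T) + prim (w i) t" for i t
  define X1 where "X1 i t = w i t - x i / T" for i t
  \<comment> \<open>The time derivative of \<open>r i\<close>, the right side left for
    \<open>P w\<close> once the coupling is moved over.\<close>
  define R where "R i t = - b t + \<gamma> / T * ((\<Sum>j<n. x j) - x i) + a i * x i * (1 - t / T)
      - (\<gamma> * (s t - w i t) - a i * prim (w i) t)" for i t
  \<comment> \<open>The inverse of \<open>P\<close>, by the rank-one update formula, applied to
    \<open>R\<close>; \<open>wr\<close> applies the same inverse to \<open>r\<close>.\<close>
  define X2 where "X2 i t = (R i t - (\<Sum>j<n. R j t) / (n + 1)) / lam" for i t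
  define r where "r i t = centre (f i) t - centre (coupling w i) t" for i t
  have r': "(r i has_real_derivative R i t) (at t within {0..T})" if i: "i < n" and t: "t \<in> {0..T}" for i t
  proof -
    have "(r i has_real_derivative (- b t + \<gamma> / T * ((\<Sum>j<n. x j) - x i) + a i * x i * (1 - t / T) - 0)
      - ((\<gamma> * (s t - w i t) - a i * prim (w i) t) - 0)) (at t within {0..T})"
      unfolding r_def[abs_def] centre_def coupling_def s_def[symmetric]
      by (intro DERIV_diff DERIV_cmult DERIV_const f' prim_has_derivative continuous_on_prim sc wc i t)
    then show ?thesis by (simp add: R_def)
  qed
  have wr: "w i t = (r i t - (\<Sum>j<n. r j t) / (n + 1)) / lam" if i: "i < n" and t: "t \<in> {0..T}" for i t
  proof -
    have eq: "lam * (w j t + s t) = r j t" if "j < n" for j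
      using w[OF that t] by (simp add: foc_op_def r_def s_def)
    have "(\<Sum>j<n. r j t) = lam * (s t + n * s t)"
      by (simp add: eq[symmetric] sum_distrib_left[symmetric] sum.distrib s_def[symmetric])
    then have "(\<Sum>j<n. r j t) / (n + 1) = lam * s t" by (simp add: field_simps)
    then have "r i t - (\<Sum>j<n. r j t) / (n + 1) = lam * w i t"
      using eq[OF i] by (simp add: algebra_simps)
    then show ?thesis using lam_pos by simp
  qed
  have "solves_bvp T \<sigma> b \<gamma> lam n x \<alpha> X"
    unfolding solves_bvp_def
  proof (rule exI[of _ X1], rule exI[of _ X2], intro allI impI conjI ballI)
    fix i assume i: "i < n"
    show "X i 0 = x i" by (simp add: X_def prim_0)
    show "X i T = 0" using T_pos w0[OF i] by (simp add: X_def prim_T)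
    fix t assume t: "t \<in> {0..T}"
    show "(X i has_real_derivative X1 i t) (at t within {0..T})"
      unfolding X_def[abs_def] X1_def using T_pos
      by (auto intro!: derivative_eq_intros prim_has_derivative wc i t)
    have "((\<lambda>t. (r i t - (\<Sum>j<n. r j t) / (n + 1)) / lam - x i / T) has_real_derivative X2 i t - 0) (at t within {0..T})"
      unfolding X2_def by (intro DERIV_diff DERIV_cdivide DERIV_sum DERIV_const r' i t) auto
    then show "(X1 i has_real_derivative X2 i t) (at t within {0..T})"
      unfolding has_field_derivative_def diff_0_right
      by (rule has_derivative_transform[rotated 2]) (use t wr[OF i] in \<open>auto simp: X1_def\<close>)
    have sX2: "(\<Sum>j<n. X2 j t) = (\<Sum>j<n. R j t) / (n + 1) / lam"
    proof -
      have "(\<Sum>j<n. X2 j t) = ((\<Sum>j<n. R j t) - n * ((\<Sum>j<n. R j t) / (n + 1))) / lam"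
        by (simp add: X2_def sum_divide_distrib[symmetric] sum_subtractf)
      also have "(\<Sum>j<n. R j t) - n * ((\<Sum>j<n. R j t) / (n + 1)) = (\<Sum>j<n. R j t) / (n + 1)"
        by (simp add: field_simps)
      finally show ?thesis .
    qed
    have RX: "lam * (X2 i t + (\<Sum>j<n. X2 j t)) = R i t"
      unfolding sX2 unfolding X2_def add_divide_distrib[symmetric] using lam_pos by simp
    have s1: "(\<Sum>j\<in>{..<n} - {i}. X1 j t) = s t - (\<Sum>j<n. x j) / T - X1 i t"
      using i by (simp add: sum_diff1 X1_def s_def sum_subtractf sum_divide_distrib)
    have s2: "(\<Sum>j\<in>{..<n} - {i}. X2 j t) = (\<Sum>j<n. X2 j t) - X2 i t"
      using i by (simp add: sum_diff1)
    show "\<alpha> i * \<sigma>\<^sup>2 * X i t - 2 * lam * X2 i t =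
               b t + \<gamma> * (\<Sum>j\<in>{..<n} - {i}. X1 j t) + lam * (\<Sum>j\<in>{..<n} - {i}. X2 j t)"
    proof -
      have "a i * X i t - R i t = b t + \<gamma> * (s t - (\<Sum>j<n. x j) / T - X1 i t)"
        by (simp add: R_def X_def X1_def algebra_simps diff_divide_distrib)
      then show ?thesis unfolding s1 s2 RX[symmetric] by (simp add: a_def algebra_simps)
    qed
  qed
  then show ?thesis by blast
qed

end

theorem theorem2p2:
  fixes M :: "'a measure" and W :: "real \<Rightarrow> 'a \<Rightarrow> real"
    and T S0 \<sigma> \<gamma> lam :: real and b :: "real \<Rightarrow> real"
    and n :: nat and x \<alpha> :: "nat \<Rightarrow> real"
  assumes "brownian_motion M W"
    and "T > 0" and "\<sigma> \<ge> 0" and "\<gamma> \<ge> 0" and "lam > 0"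
    and "continuous_on {0..T} b"
    and "\<forall>i<n. \<alpha> i \<ge> 0"
  shows "\<exists>X. (\<exists>Xd. nash_mv M W T S0 \<sigma> b \<gamma> lam n x \<alpha> X Xd)
           \<and> (\<forall>Y Yd. nash_mv M W T S0 \<sigma> b \<gamma> lam n x \<alpha> Y Yd \<longrightarrow>
                 (\<forall>i<n. \<forall>t\<in>{0..T}. Y i t = X i t))
           \<and> solves_bvp T \<sigma> b \<gamma> lam n x \<alpha> X
           \<and> (\<forall>Z. solves_bvp T \<sigma> b \<gamma> lam n x \<alpha> Z \<longrightarrow>
                 (\<forall>i<n. \<forall>t\<in>{0..T}. Z i t = X i t))"
proof -
  interpret market T M W S0 \<sigma> \<gamma> lam b n x \<alpha>
    using assms by unfold_locales auto
  obtain X where X: "solves_bvp T \<sigma> b \<gamma> lam n x \<alpha> X"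
    using bvp_solvable by blast
  from bvp_imp_nash[OF this] obtain Xd where Xd: "nash_mv M W T S0 \<sigma> b \<gamma> lam n x \<alpha> X Xd" by blast
  show ?thesis
  proof (rule exI[of _ X], intro conjI allI impI ballI)
    show "\<exists>Xd. nash_mv M W T S0 \<sigma> b \<gamma> lam n x \<alpha> X Xd" using Xd by blast
    show "Y i t = X i t" if "nash_mv M W T S0 \<sigma> b \<gamma> lam n x \<alpha> Y Yd" "i < n" "t \<in> {0..T}" for Y Yd i t
      using nash_unique[OF Xd that] .
    show "solves_bvp T \<sigma> b \<gamma> lam n x \<alpha> X" by (rule X)
    show "Z i t = X i t" if "solves_bvp T \<sigma> b \<gamma> lam n x \<alpha> Z" "i < n" "t \<in> {0..T}" for Z i t
      using bvp_imp_nash[OF that(1)] nash_unique[OF Xd _ that(2,3)] by blast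
  qed
qed

end
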